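(* Let $n$ be a positive integer with $n\equiv 1\pmod 6$. Then, modulo $\Phi_n(q)^3$, \begin{align*} \sum_{k=0}^{(2n+1)/3}\frac{(q^{-1};q^3)_k^3}{(q^3;q^3)_k^3}q^{9k} &\equiv q^{(2-2n)/3}(1+q)\frac{(q;q^3)_{(2n+1)/3}^2}{(q^3;q^3)_{(2n+1)/3}^2}\\ &\quad\times\bigg\{3-[2n]^2\bigg(\sum_{i=1}^{(2n+1)/3}\frac{3q^{3i-2}}{[3i-2]^2}-\frac{1+5q+3q^2}{1+q}\bigg)\bigg\}. \end{align*}
   Context: For a variable $x$ and base $q$, the $q$-shifted factorial is $(x;q)_0=1$ and $(x;q)_k=(1-x)(1-xq)\cdots(1-xq^{k-1})$ for positive integers $k$. The $q$-integer is $[m]=(1-q^m)/(1-q)$. $\Phi_n(q)$ denotes the $n$-th cyclotomic polynomial in $q$. A congruence $A(q)\equiv B(q)\pmod{\Phi_n(q)^3}$ between rational functions in $q$ whose denominators are coprime to $\Phi_n(q)$ means that the numerator of $A(q)-B(q)$ (in lowest terms) is divisible by $\Phi_n(q)^3$ in $\mathbb{Z}[q]$.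
   Formalization: The case n = 1 is excluded (n > 1 is assumed): there the congruence modulo Φ_1(q)^3 fails, since at q = 1 the left side equals 26/27 and the right side equals 2. *)

theory Defs
  imports
    "HOL-Computational_Algebra.Computational_Algebra"
    "HOL-Number_Theory.Totient"
    Complex_Main
begin

type_synonym ratfun = "int poly fract"

definition qvar :: ratfun where
  "qvar = Fract [:0, 1:] 1"

definition q_shifted_factorial :: "'a::comm_ring_1 \<Rightarrow> 'a \<Rightarrow> nat \<Rightarrow> 'a" where
  "q_shifted_factorial x b k = (\<Prod>j<k. 1 - x * b ^ j)"

definition q_integer :: "nat \<Rightarrow> ratfun" where
  "q_integer m = (1 - qvar ^ m) / (1 - qvar)"

definition cyclotomic :: "nat \<Rightarrow> int poly" where
  "cyclotomic n = (THE p. map_poly complex_of_int p =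
     (\<Prod>k\<in>totatives n. [:- cis (2 * pi * real k / real n), 1:]))"

text \<open>
  The library function \<^const>\<open>quot_of_fract\<close> returns numerator and denominator in lowest terms over
  \<open>\<int>[q]\<close>.  The congruence presupposes denominators coprime to the modulus.  This excludes
  \<open>n = 1\<close> from the theorem: there the denominators \<open>(q\<^sup>3;q\<^sup>3)\<^sub>k\<close> are divisible by
  \<open>\<Phi>\<^sub>1(q) = q - 1\<close>, and after cancellation the two sides take the values \<open>26/27\<close> and \<open>2\<close> at \<open>q = 1\<close>.
\<close>

definition ratfun_cong :: "ratfun \<Rightarrow> ratfun \<Rightarrow> int poly \<Rightarrow> bool" where
  "ratfun_cong A B M \<longleftrightarrow>
     coprime (snd (quot_of_fract A)) M \<and>
     coprime (snd (quot_of_fract B)) M \<and>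
     M dvd fst (quot_of_fract (A - B))"

text \<open>
  The definite description defining \<^const>\<open>cyclotomic\<close> is proper: the complex product has integer
  coefficients for every positive \<open>n\<close>.
\<close>

lemma map_poly_complex_of_int_mult:
  "map_poly complex_of_int (p * q) = map_poly complex_of_int p * map_poly complex_of_int q"
  by (rule poly_eqI) (simp add: coeff_map_poly coeff_mult)

lemma map_poly_complex_of_int_add:
  "map_poly complex_of_int (p + q) = map_poly complex_of_int p + map_poly complex_of_int q"
  by (rule poly_eqI) (simp add: coeff_map_poly)

lemma map_poly_complex_of_int_prod:
  "map_poly complex_of_int (prod f A) = (\<Prod>x\<in>A. map_poly complex_of_int (f x))"
  by (induction A rule: infinite_finite_induct) (simp_all add: map_poly_complex_of_int_mult)

lemma map_poly_complex_of_int_inj: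
  "map_poly complex_of_int p = map_poly complex_of_int q \<longleftrightarrow> p = q"
  by (auto simp: poly_eq_iff coeff_map_poly)

lemma degree_map_poly_complex_of_int:
  "degree (map_poly complex_of_int p) = degree p"
  by (rule degree_map_poly) simp

lemma prod_roots_unity:
  assumes "n > 0"
  shows "(\<Prod>k\<in>{0<..n}. [:- cis (2 * pi * real k / real n), 1:]) = monom 1 n - 1"
proof -
  let ?f = "\<lambda>k. cis (2 * pi * real k / real n)"
  let ?Z = "{z::complex. z ^ n = 1}"
  have finZ: "finite ?Z"
    using bij_betw_finite[OF bij_betw_roots_unity[OF assms]] by simp
  have fn: "?f n = 1" "?f 0 = 1"
    using assms by simp_all
  have "{0<..n} = insert n {0<..<n}" "{..<n} = insert 0 {0<..<n}"
    using assms by auto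
  then have "(\<Prod>k\<in>{0<..n}. [:- ?f k, 1:]) = (\<Prod>k<n. [:- ?f k, 1:])"
    using fn by simp
  also have "\<dots> = (\<Prod>z\<in>?Z. [:- z, 1:])"
    by (rule prod.reindex_bij_betw[OF bij_betw_roots_unity[OF assms]])
  also have "\<dots> = monom 1 n - 1"
  proof (rule ccontr)
    let ?P = "\<Prod>z\<in>?Z. [:- z, 1:]" and ?Q = "monom 1 n - 1 :: complex poly"
    assume neq: "?P \<noteq> ?Q"
    have cardZ: "card ?Z = n"
      using card_roots_unity_eq[OF assms] by simp
    have degP: "degree ?P = n"
      by (subst degree_prod_eq_sum_degree) (simp_all add: cardZ)
    have leadP: "lead_coeff ?P = 1"
      by (subst lead_coeff_prod) simp
    have cQ: "coeff ?Q n = 1" and degQ: "degree ?Q \<le> n"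
      using assms by (simp_all add: degree_diff_le degree_monom_le)
    have le: "degree (?P - ?Q) \<le> n"
      by (rule degree_diff_le) (use degP degQ in auto)
    have "coeff (?P - ?Q) n = 0"
      using leadP cQ degP by simp
    then have "degree (?P - ?Q) \<noteq> n"
      using neq leading_coeff_0_iff[of "?P - ?Q"] by auto
    then have lt: "degree (?P - ?Q) < n"
      using le by simp
    have "?Z \<subseteq> {z. poly (?P - ?Q) z = 0}"
      using finZ by (auto simp: poly_prod poly_monom prod_zero_iff)
    moreover have "finite {z. poly (?P - ?Q) z = 0}"
      using neq by (intro poly_roots_finite) simp
    ultimately have "card ?Z \<le> card {z. poly (?P - ?Q) z = 0}"
      by (intro card_mono)
    also have "\<dots> \<le> degree (?P - ?Q)"
      using neq by (intro card_poly_roots_bound) simp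
    finally show False
      using lt cardZ by simp
  qed
  finally show ?thesis .
qed

lemma prod_totatives_divisors:
  assumes "n > 0"
  shows "(\<Prod>d | d dvd n. \<Prod>k\<in>totatives d. [:- cis (2 * pi * real k / real d), 1:]) = monom 1 n - 1"
proof -
  let ?g = "\<lambda>d k. [:- cis (2 * pi * real k / real d), 1:]"
  let ?D = "{d. d dvd n}"
  have fin: "finite ?D"
    using assms by simp
  have inner: "(\<Prod>k\<in>totatives (n div d). ?g (n div d) k) = (\<Prod>k | k \<in> {0<..n} \<and> gcd k n = d. ?g n k)"
    if "d dvd n" for d
  proof -
    have d: "d > 0"
      using that assms by (auto intro: Nat.gr0I)
    have "?g (n div d) k = ?g n (k * d)" for k
      using d assms that by (simp add: real_of_nat_div field_simps)
    then have "(\<Prod>k\<in>totatives (n div d). ?g (n div d) k) = (\<Prod>k\<in>totatives (n div d). ?g n (k * d))"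
      by simp
    also have "\<dots> = (\<Prod>k | k \<in> {0<..n} \<and> gcd k n = d. ?g n k)"
      by (rule prod.reindex_bij_betw[OF bij_betw_totatives_gcd_eq[OF that assms]])
    finally show ?thesis .
  qed
  have div_div: "n div (n div d) = d" if "d dvd n" for d
    using that assms by (metis dvd_div_eq_0_iff dvd_div_mult_self less_numeral_extra(3)
        nonzero_mult_div_cancel_left)
  have div_dvd: "n div d dvd n" if "d dvd n" for d
    using that by (metis dvd_div_mult_self dvd_triv_left)
  have "(\<Prod>d\<in>?D. \<Prod>k\<in>totatives d. ?g d k) = (\<Prod>d\<in>?D. \<Prod>k\<in>totatives (n div d). ?g (n div d) k)"
    by (rule prod.reindex_bij_witness[of _ "\<lambda>d. n div d" "\<lambda>d. n div d"])
       (simp_all add: div_div div_dvd)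
  also have "\<dots> = (\<Prod>d\<in>?D. \<Prod>k | k \<in> {0<..n} \<and> gcd k n = d. ?g n k)"
    by (intro prod.cong refl inner) simp
  also have "\<dots> = (\<Prod>k\<in>{0<..n}. ?g n k)"
    by (rule prod.group) (use fin in auto)
  also have "\<dots> = monom 1 n - 1"
    by (rule prod_roots_unity[OF assms])
  finally show ?thesis .
qed

lemma monic_int_poly_divide:
  assumes "map_poly complex_of_int f = map_poly complex_of_int g * h" and "lead_coeff g = 1"
  shows "\<exists>p. map_poly complex_of_int p = h"
proof -
  obtain p r where pr: "pseudo_divmod f g = (p, r)"
    by fastforce
  have g: "g \<noteq> 0"
    using assms(2) by auto
  have f: "f = g * p + r" and r: "r = 0 \<or> degree r < degree g"
    using pseudo_divmod[OF g pr] assms(2) by simp_all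
  let ?i = "map_poly complex_of_int"
  have eq: "?i g * (h - ?i p) = ?i r"
    using assms(1)
    by (simp add: f map_poly_complex_of_int_mult map_poly_complex_of_int_add algebra_simps)
  have "h - ?i p = 0"
  proof (rule ccontr)
    assume h: "h - ?i p \<noteq> 0"
    have ig: "?i g \<noteq> 0"
      using g map_poly_complex_of_int_inj[of g 0] by simp
    have "degree (?i r) = degree (?i g) + degree (h - ?i p)"
      using degree_mult_eq[OF ig h] eq by simp
    moreover have "r \<noteq> 0"
      using eq ig h by auto
    ultimately show False
      using r by (simp add: degree_map_poly_complex_of_int)
  qed
  then show ?thesis
    by auto
qed

lemma cyclotomic_ex:
  assumes "n > 0"
  shows "\<exists>p. map_poly complex_of_int p =
     (\<Prod>k\<in>totatives n. [:- cis (2 * pi * real k / real n), 1:])"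
  using assms
proof (induction n rule: less_induct)
  case (less n)
  let ?C = "\<lambda>n. \<Prod>k\<in>totatives n. [:- cis (2 * pi * real k / real n), 1:]"
  let ?i = "map_poly complex_of_int"
  let ?D = "{d. d dvd n \<and> d \<noteq> n}"
  have ex: "\<forall>d\<in>?D. \<exists>p. ?i p = ?C d"
  proof
    fix d assume "d \<in> ?D"
    then have "d < n" "d > 0"
      using less.prems dvd_imp_le[of d n] dvd_pos_nat[of n d] by auto
    then show "\<exists>p. ?i p = ?C d"
      by (rule less.IH)
  qed
  obtain P where P: "\<And>d. d \<in> ?D \<Longrightarrow> ?i (P d) = ?C d"
    using bchoice[OF ex] by blast
  let ?g = "prod P ?D"
  have ig: "?i ?g = (\<Prod>d\<in>?D. ?C d)"
    by (simp add: map_poly_complex_of_int_prod P)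
  have "lead_coeff (?i ?g) = 1"
    unfolding ig by (simp add: lead_coeff_prod)
  then have lead: "lead_coeff ?g = 1"
    by (simp add: degree_map_poly_complex_of_int coeff_map_poly)
  have D: "{d. d dvd n} = insert n ?D" "finite ?D" "n \<notin> ?D"
    using less.prems by auto
  have "?i (monom 1 n - 1) = monom 1 n - 1"
    by (rule poly_eqI) (simp add: coeff_map_poly)
  also have "\<dots> = (\<Prod>d | d dvd n. ?C d)"
    using prod_totatives_divisors[OF less.prems] by simp
  also have "\<dots> = ?i ?g * ?C n"
    unfolding D(1) ig by (subst prod.insert) (use D in auto)
  finally show ?case
    by (rule monic_int_poly_divide) (rule lead)
qed

lemma map_poly_cyclotomic:
  assumes "n > 0"
  shows "map_poly complex_of_int (cyclotomic n) =
    (\<Prod>k\<in>totatives n. [:- cis (2 * pi * real k / real n), 1:])"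
proof -
  obtain p where p: "map_poly complex_of_int p =
     (\<Prod>k\<in>totatives n. [:- cis (2 * pi * real k / real n), 1:])"
    using cyclotomic_ex[OF assms] by blast
  show ?thesis
    unfolding cyclotomic_def
  proof (rule theI)
    show "map_poly complex_of_int p =
      (\<Prod>k\<in>totatives n. [:- cis (2 * pi * real k / real n), 1:])"
      by (rule p)
  next
    fix p'
    assume "map_poly complex_of_int p' =
      (\<Prod>k\<in>totatives n. [:- cis (2 * pi * real k / real n), 1:])"
    then show "p' = p"
      using p map_poly_complex_of_int_inj[of p' p] by simp
  qed
qed

end

theory Submission
  imports Defs
begin

text \<open>
  Write \<open>p = q\<^sup>3\<close>, \<open>n = 3r + 1\<close>, \<open>N = (2n + 1)/3 = 2r + 1\<close> and, for integers \<open>\<alpha>, \<beta>, \<gamma>\<close>, let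
  \<open>G(\<alpha>, \<beta>, \<gamma>)\<close> be the sum over \<open>k \<le> N\<close> of
  \<open>(q\<^bsup>\<alpha>n-1\<^esup>;p)\<^sub>k (q\<^bsup>\<beta>n-1\<^esup>;p)\<^sub>k (q\<^bsup>\<gamma>n-1\<^esup>;p)\<^sub>k / (p;p)\<^sub>k\<^sup>3 p\<^bsup>3k\<^esup>\<close>.  Since \<open>q\<^sup>n \<equiv> 1\<close> modulo
  \<open>\<Phi>\<^sub>n\<close>, each factor is modulo \<open>\<Phi>\<^sub>n\<^sup>3\<close> a quadratic polynomial in its exponent, whence
  \<open>G(0, 0, 0) \<equiv> 4 G(-2, 1, 1) - 3 G(-2, 0, 2)\<close>.  As \<open>q\<^bsup>-2n-1\<^esup> = p\<^bsup>-N\<^esup>\<close>, both sums on the right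
  terminate.  The first one vanishes, because \<open>q\<^bsup>n-1\<^esup> = p\<^sup>r\<close> turns it into an \<open>N\<close>-th \<open>p\<close>-difference of
  a polynomial of degree \<open>2r < N\<close>.  The second one is a combination of three balanced sums,
  evaluated by the \<open>q\<close>-Saalschuetz formula, and equals \<open>(q;p)\<^sub>N\<^sup>2 / (p;p)\<^sub>N\<^sup>2\<close> times a factor congruent
  to \<open>3 q\<^bsup>-2r\<^esup> (1 + q)\<close> modulo \<open>\<Phi>\<^sub>n\<close>.  As \<open>(q;p)\<^sub>N\<close> contains \<open>1 - q\<^sup>n\<close>, only this residue matters.
  On the right-hand side of the theorem, likewise, the only term of the inner sum that matters is
  \<open>i = r + 1\<close>, where \<open>[2n]\<^sup>2 3 q\<^sup>n / [n]\<^sup>2 \<equiv> 12\<close>, so that the bracket is congruent to \<open>-9\<close>.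
\<close>

section \<open>Terminating basic hypergeometric sums\<close>

lemma qsf_0 [simp]: "q_shifted_factorial x b 0 = 1"
  by (simp add: q_shifted_factorial_def)

lemma qsf_Suc: "q_shifted_factorial x b (Suc k) = q_shifted_factorial x b k * (1 - x * b ^ k)"
  by (simp add: q_shifted_factorial_def)

text \<open>Both sides equal \<open>q_shifted_factorial x b (Suc k)\<close>, split at its first or
  its last factor. This form without division serves the later shifts of parameters by one step of
  the base.\<close>

lemma qsf_shift: "q_shifted_factorial (x * b) b k * (1 - x) = q_shifted_factorial x b k * (1 - x * b ^ k)"
proof (induction k)
  case (Suc k)
  have "q_shifted_factorial (x * b) b (Suc k) * (1 - x) =
      (q_shifted_factorial (x * b) b k * (1 - x)) * (1 - x * b ^ Suc k)"
    by (simp add: qsf_Suc mult_ac)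
  also have "\<dots> = q_shifted_factorial x b (Suc k) * (1 - x * b ^ Suc k)"
    unfolding Suc.IH by (simp add: qsf_Suc)
  finally show ?case .
qed simp

lemma qsf_add:
  "q_shifted_factorial x b (m + k) = q_shifted_factorial x b m * q_shifted_factorial (x * b ^ m) b k"
  by (induction k) (simp_all add: qsf_Suc power_add mult_ac)

lemma qsf_Suc': "q_shifted_factorial x b (Suc k) = (1 - x) * q_shifted_factorial (x * b) b k"
  using qsf_add[of x b 1 k] by (simp add: qsf_Suc)

lemma qsf_nonzero:
  fixes x b :: "'a::idom"
  assumes "\<And>j. j < k \<Longrightarrow> x * b ^ j \<noteq> 1"
  shows "q_shifted_factorial x b k \<noteq> 0"
  using assms by (auto simp: q_shifted_factorial_def)

lemma qsf_base_nonzero: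
  fixes p :: "'a::idom"
  assumes "\<And>j. j > 0 \<Longrightarrow> p ^ j \<noteq> 1"
  shows "q_shifted_factorial p p k \<noteq> 0"
  by (rule qsf_nonzero) (use assms[of "Suc _"] in auto)

section \<open>Balanced sums and the q-Saalschuetz formula\<close>

definition saalschuetz_term :: "'a::field \<Rightarrow> 'a \<Rightarrow> nat \<Rightarrow> nat \<Rightarrow> 'a" where
  "saalschuetz_term p b N k =
     q_shifted_factorial (1 / p ^ N) p k * q_shifted_factorial b p k *
     q_shifted_factorial (p ^ (N + 1) / b) p k / q_shifted_factorial p p k ^ 3 * p ^ k"

text \<open>
  The rational function \<open>\<kappa> (1 - v)\<^sup>3 / (v (a - v))\<close>, with \<open>a = p\<^bsup>N+1\<^esup>\<close> and \<open>v = p\<^bsup>k\<^esup>\<close>, is the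
  Wilf--Zeilberger certificate for the recurrence in \<open>N\<close> of the terminating balanced sum
  \<open>\<^sub>3\<phi>\<^sub>2(p\<^bsup>-N\<^esup>, b, p\<^bsup>N+1\<^esup>/b; p, p; p, p)\<close>.
\<close>

lemma saalschuetz_certificate:
  fixes a b v :: "'a::field"
  assumes "a \<noteq> 0" "b \<noteq> 0" "v \<noteq> 0" "a \<noteq> 1" "b \<noteq> a" "a \<noteq> v"
  defines "\<kappa> \<equiv> - a * (a\<^sup>2 - b) / ((b - a) * (a - 1)\<^sup>2)"
  shows "\<kappa> * (1 - v) ^ 3 / ((a - v) * v) +
      ((a - 1) * (b - a * v) / ((a - v) * (b - a)) - (b - a)\<^sup>2 / (b * (a - 1)\<^sup>2)) =
    \<kappa> * (1 - b * v) * (1 - a * v / b) / (a * v)"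
proof -
  have ne: "b - a \<noteq> 0" "a - v \<noteq> 0" "a - 1 \<noteq> 0" using assms by auto
  show ?thesis
    unfolding \<kappa>_def using ne assms(1-3)
    by (simp add: divide_simps) (simp add: power2_eq_square power3_eq_cube algebra_simps)
qed

text \<open>Raising \<open>N\<close> shifts the parameters \<open>1 / p ^ N\<close> and
  \<open>p ^ (N + 1) / b\<close> by one power of \<open>p\<close>, each a case of
  \<open>qsf_shift\<close>. The pole at \<open>k = N + 1\<close> is treated in
  \<open>saalschuetz_term_diag\<close>.\<close>

lemma saalschuetz_term_Suc_left:
  fixes p b :: "'a::field"
  assumes "p \<noteq> 0" "b \<noteq> 0" "p ^ (N + 1) \<noteq> b" "p ^ (N + 1) \<noteq> p ^ k"
  shows "saalschuetz_term p b (Suc N) k = saalschuetz_term p b N k *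
    ((p ^ (N + 1) - 1) * (b - p ^ (N + 1) * p ^ k) / ((p ^ (N + 1) - p ^ k) * (b - p ^ (N + 1))))"
proof -
  let ?a = "p ^ (N + 1)" and ?u = "p ^ k"
  let ?A = "q_shifted_factorial (1 / p ^ Suc N) p k" and ?A' = "q_shifted_factorial (1 / p ^ N) p k"
  let ?C = "q_shifted_factorial (p ^ (Suc N + 1) / b) p k" and ?C' = "q_shifted_factorial (p ^ (N + 1) / b) p k"
  have a0: "?a \<noteq> 0" using assms by simp
  have "?A' * (1 - 1 / ?a) = ?A * (1 - 1 / ?a * ?u)"
    using qsf_shift[of "1 / ?a" p k] assms by simp
  hence A: "?A * (?a - ?u) = ?A' * (?a - 1)"
    using a0 by (simp add: field_simps)
  have "?C * (1 - ?a / b) = ?C' * (1 - ?a / b * ?u)"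
    using qsf_shift[of "?a / b" p k] by (simp add: algebra_simps)
  hence C: "?C * (b - ?a) = ?C' * (b - ?a * ?u)"
    using assms(2) by (simp add: field_simps)
  have "(?A * ?C) * ((?a - ?u) * (b - ?a)) = (?A' * ?C') * ((?a - 1) * (b - ?a * ?u))"
  proof -
    have "(?A * ?C) * ((?a - ?u) * (b - ?a)) = (?A * (?a - ?u)) * (?C * (b - ?a))"
      by (simp only: mult_ac)
    also have "\<dots> = (?A' * ?C') * ((?a - 1) * (b - ?a * ?u))"
      unfolding A C by (simp only: mult_ac)
    finally show ?thesis .
  qed
  hence AC: "?A * ?C = ?A' * ?C' * ((?a - 1) * (b - ?a * ?u) / ((?a - ?u) * (b - ?a)))"
    using eq_divide_imp[of "(?a - ?u) * (b - ?a)" "?A * ?C"] assms by (simp del: power_Suc)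
  have "saalschuetz_term p b (Suc N) k = (?A * ?C) * (q_shifted_factorial b p k / q_shifted_factorial p p k ^ 3 * p ^ k)"
    by (simp add: saalschuetz_term_def)
  also have "\<dots> = saalschuetz_term p b N k * ((?a - 1) * (b - ?a * ?u) / ((?a - ?u) * (b - ?a)))"
    unfolding AC by (simp add: saalschuetz_term_def mult_ac)
  finally show ?thesis .
qed

lemma saalschuetz_term_Suc_right:
  fixes p b :: "'a::field"
  assumes "p \<noteq> 0" "\<And>j. j > 0 \<Longrightarrow> p ^ j \<noteq> 1"
  shows "saalschuetz_term p b N (Suc k) * (p ^ (N + 1) * (1 - p ^ Suc k) ^ 3) =
    saalschuetz_term p b N k *
      (p * (p ^ (N + 1) - p ^ Suc k) * (1 - b * p ^ k) * (1 - p ^ (N + 1) * p ^ k / b))"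
proof -
  have ne: "q_shifted_factorial p p k \<noteq> 0"
    using assms(2) by (rule qsf_base_nonzero)
  have 1: "1 - p ^ Suc k \<noteq> 0" using assms(2)[of "Suc k"] by auto
  have "(1 - 1 / p ^ N * p ^ k) * p ^ (N + 1) = p * (p ^ N - p ^ k)"
    using assms(1) by (simp add: field_simps)
  then show ?thesis
    using ne 1 assms(1)
    by (simp add: saalschuetz_term_def qsf_Suc power_mult_distrib)
      (simp add: divide_simps, simp add: algebra_simps)
qed


text \<open>The sum telescopes: by the certificate each summand is G(k+1) - G(k), and G(0) = 0
  because of the factor \<open>(1 - v) ^ 3\<close> at \<open>v = 1\<close>. Writing G(m+1) through
  the term at \<open>m\<close> avoids the pole of the certificate at index
  \<open>N + 1\<close>.\<close>

lemma saalschuetz_partial_sum: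
  fixes p b :: "'a::field"
  assumes p: "p \<noteq> 0" "\<And>j. j > 0 \<Longrightarrow> p ^ j \<noteq> 1" "inj ((^) p)"
    and b: "b \<noteq> 0" "b \<noteq> p ^ (N + 1)" and m: "m \<le> N"
  defines "a \<equiv> p ^ (N + 1)"
  defines "\<kappa> \<equiv> - a * (a\<^sup>2 - b) / ((b - a) * (a - 1)\<^sup>2)"
  shows "(\<Sum>k\<le>m. saalschuetz_term p b (Suc N) k -
      (b - a)\<^sup>2 / (b * (a - 1)\<^sup>2) * saalschuetz_term p b N k) =
    saalschuetz_term p b N m * (\<kappa> * (1 - b * p ^ m) * (1 - a * p ^ m / b) / (a * p ^ m))"
  using m
proof (induction m)
  have a: "a \<noteq> 0" "a \<noteq> 1" "b \<noteq> a"
    using p b p(2)[of "N + 1"] unfolding a_def by auto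
  have summand: "saalschuetz_term p b (Suc N) k -
      (b - a)\<^sup>2 / (b * (a - 1)\<^sup>2) * saalschuetz_term p b N k =
      saalschuetz_term p b N k * ((a - 1) * (b - a * p ^ k) / ((a - p ^ k) * (b - a)) -
         (b - a)\<^sup>2 / (b * (a - 1)\<^sup>2))" "a \<noteq> p ^ k" if "k \<le> N" for k
  proof -
    show ne: "a \<noteq> p ^ k"
      using that injD[OF p(3), of "N + 1" k] unfolding a_def by auto
    show "saalschuetz_term p b (Suc N) k -
      (b - a)\<^sup>2 / (b * (a - 1)\<^sup>2) * saalschuetz_term p b N k =
      saalschuetz_term p b N k * ((a - 1) * (b - a * p ^ k) / ((a - p ^ k) * (b - a)) -
         (b - a)\<^sup>2 / (b * (a - 1)\<^sup>2))"
      using saalschuetz_term_Suc_left[of p b N k] ne p b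
      unfolding a_def by (simp add: right_diff_distrib mult.commute)
  qed
  {
    case 0
    show ?case
      using summand[of 0] saalschuetz_certificate[of a b 1] a b unfolding \<kappa>_def
      by (simp add: saalschuetz_term_def)
  next
    case (Suc m)
    let ?u = "p ^ m" and ?v = "p ^ Suc m"
    let ?t = "saalschuetz_term p b N"
    have v: "?v \<noteq> 0" "a \<noteq> ?v" "1 - ?v \<noteq> 0"
      using p(1) p(2)[of "Suc m"] summand(2)[OF Suc.prems] by auto
    \<comment> \<open>The value expressed at \<open>m\<close> becomes the certificate times the term
      at \<open>Suc m\<close>, ready for the next summand.\<close>
    have "?t m * (\<kappa> * (1 - b * ?u) * (1 - a * ?u / b) / (a * ?u)) =
        (?t m * (p * (a - ?v) * (1 - b * ?u) * (1 - a * ?u / b))) * (\<kappa> / (a * ?v * (a - ?v)))"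
      using a v p(1) by simp
    also have "\<dots> = (?t (Suc m) * (a * (1 - ?v) ^ 3)) * (\<kappa> / (a * ?v * (a - ?v)))"
      using saalschuetz_term_Suc_right[OF p(1,2), of b N m] unfolding a_def by (simp only:)
    also have "\<dots> = ?t (Suc m) * (\<kappa> * (1 - ?v) ^ 3 / ((a - ?v) * ?v))"
      using a v by (simp add: mult_ac)
    finally have "(\<Sum>k\<le>Suc m. saalschuetz_term p b (Suc N) k -
        (b - a)\<^sup>2 / (b * (a - 1)\<^sup>2) * saalschuetz_term p b N k) =
      ?t (Suc m) * (\<kappa> * (1 - ?v) ^ 3 / ((a - ?v) * ?v) +
        ((a - 1) * (b - a * ?v) / ((a - ?v) * (b - a)) - (b - a)\<^sup>2 / (b * (a - 1)\<^sup>2)))"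
      using Suc summand(1)[OF Suc.prems] by (simp only: sum.atMost_Suc Suc_leD distrib_left)
    also have "\<dots> = ?t (Suc m) * (\<kappa> * (1 - b * ?v) * (1 - a * ?v / b) / (a * ?v))"
      using saalschuetz_certificate[of a b ?v] a b v unfolding \<kappa>_def by simp
    finally show ?case .
  }
qed

text \<open>At \<open>k = N + 1\<close> the term for \<open>N\<close> vanishes while the ratio in
  \<open>saalschuetz_term_Suc_left\<close> has a pole. The comparison is therefore with the term at
  \<open>k = N\<close>, after splitting off the first factor of (p^(-N-1);p)_(N+1).\<close>

lemma saalschuetz_term_diag:
  fixes p b :: "'a::field"
  assumes p: "p \<noteq> 0" "\<And>j. j > 0 \<Longrightarrow> p ^ j \<noteq> 1"
    and b: "b \<noteq> 0" "b \<noteq> p ^ (N + 1)"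
  defines "a \<equiv> p ^ (N + 1)"
  shows "saalschuetz_term p b (Suc N) (Suc N) = saalschuetz_term p b N N *
    (p * (a\<^sup>2 - b) / (a * (b - a) * (a - 1)\<^sup>2) * (1 - b * p ^ N) * (1 - a * p ^ N / b))"
proof -
  let ?A' = "q_shifted_factorial (1 / p ^ N) p N"
  let ?C = "q_shifted_factorial (p ^ (Suc N + 1) / b) p (Suc N)" and ?C' = "q_shifted_factorial (p ^ (N + 1) / b) p N"
  have a: "a \<noteq> 0" "a - 1 \<noteq> 0" "b - a \<noteq> 0" "1 - a \<noteq> 0"
    using p b p(2)[of "N + 1"] unfolding a_def by auto
  have A: "q_shifted_factorial (1 / p ^ Suc N) p (Suc N) = (1 - 1 / a) * ?A'"
    using p(1) by (subst qsf_Suc') (simp add: a_def)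
  have C0: "?C * (1 - a / b) = ?C' * (1 - a * p ^ N / b) * (1 - a\<^sup>2 / b)"
    using qsf_shift[of "a / b" p "Suc N"] unfolding a_def
    by (simp add: qsf_Suc[of "_ / b"] power2_eq_square mult_ac)
  have C: "?C = ?C' * (1 - a * p ^ N / b) * ((b - a\<^sup>2) / (b - a))"
  proof -
    have 0: "1 - a / b = (b - a) / b" and 1: "1 - a\<^sup>2 / b = (b - a\<^sup>2) / b"
      using b by (simp_all add: diff_divide_distrib)
    have "?C = ?C' * (1 - a * p ^ N / b) * (1 - a\<^sup>2 / b) / (1 - a / b)"
      by (rule eq_divide_imp) (use C0 a b 0 in auto)
    then show ?thesis using b by (simp add: 0 1)
  qed
  have D: "q_shifted_factorial p p (Suc N) = q_shifted_factorial p p N * (1 - a)"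
    by (simp add: qsf_Suc a_def)
  have "(1 - 1 / a) * ((b - a\<^sup>2) / (b - a)) / (1 - a) ^ 3 = (a\<^sup>2 - b) / (a * (b - a) * (a - 1)\<^sup>2)"
  proof -
    have "(1 - a) ^ 3 = - ((a - 1) * (a - 1)\<^sup>2)"
      by (simp add: power2_eq_square power3_eq_cube algebra_simps)
    then show ?thesis using a by (simp add: divide_simps)
  qed
  then have E: "p * (a\<^sup>2 - b) / (a * (b - a) * (a - 1)\<^sup>2) =
      p * ((1 - 1 / a) * ((b - a\<^sup>2) / (b - a)) / (1 - a) ^ 3)" by simp
  show ?thesis
    unfolding saalschuetz_term_def A C D E
    by (simp add: qsf_Suc power_mult_distrib mult_ac)
qed

text \<open>At \<open>m = N\<close> the partial sum lemma yields minus the diagonal term, so the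
  full sum obeys a first-order recurrence in \<open>N\<close>, which the right-hand side satisfies
  as well.\<close>

lemma saalschuetz_special:
  fixes p b :: "'a::field"
  assumes p: "p \<noteq> 0" "\<And>j. j > 0 \<Longrightarrow> p ^ j \<noteq> 1" "inj ((^) p)"
    and b: "b \<noteq> 0" "\<And>j. b \<noteq> p ^ j"
  shows "(\<Sum>k\<le>N. saalschuetz_term p b N k) =
    b ^ N * (q_shifted_factorial (p / b) p N / q_shifted_factorial p p N)\<^sup>2"
proof (induction N)
  case 0
  show ?case by (simp add: saalschuetz_term_def)
next
  case (Suc N)
  let ?a = "p ^ (N + 1)"
  let ?r = "(b - ?a)\<^sup>2 / (b * (?a - 1)\<^sup>2)"
  have a: "?a \<noteq> 0" "?a - 1 \<noteq> 0" "b - ?a \<noteq> 0" "p ^ N \<noteq> 0"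
    using p(1) p(2)[of "N + 1"] b(2)[of "N + 1"] by auto
  have "(\<Sum>k\<le>N. saalschuetz_term p b (Suc N) k) - ?r * (\<Sum>k\<le>N. saalschuetz_term p b N k) =
      saalschuetz_term p b N N * ((- ?a * (?a\<^sup>2 - b) / ((b - ?a) * (?a - 1)\<^sup>2)) * (1 - b * p ^ N) *
        (1 - ?a * p ^ N / b) / (?a * p ^ N))"
    using saalschuetz_partial_sum[OF p b(1) b(2) order.refl] by (simp add: sum_subtractf sum_distrib_left)
  also have "\<dots> = - saalschuetz_term p b (Suc N) (Suc N)"
  proof -
    have "(- ?a * (?a\<^sup>2 - b) / ((b - ?a) * (?a - 1)\<^sup>2)) / (?a * p ^ N) =
        - (p * (?a\<^sup>2 - b) / (?a * (b - ?a) * (?a - 1)\<^sup>2))"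
      using a p(1) by (simp add: divide_simps)
    then have "(- ?a * (?a\<^sup>2 - b) / ((b - ?a) * (?a - 1)\<^sup>2)) * X * Y / (?a * p ^ N) =
        - (p * (?a\<^sup>2 - b) / (?a * (b - ?a) * (?a - 1)\<^sup>2) * X * Y)" for X Y
      by (metis (no_types, opaque_lifting) mult_minus_left times_divide_eq_left)
    then show ?thesis
      by (simp only: saalschuetz_term_diag[OF p(1,2) b(1) b(2)] mult_minus_right)
  qed
  finally have "(\<Sum>k\<le>Suc N. saalschuetz_term p b (Suc N) k) = ?r * (\<Sum>k\<le>N. saalschuetz_term p b N k)"
    by (simp add: algebra_simps)
  also have "\<dots> = ?r * (b ^ N * (q_shifted_factorial (p / b) p N / q_shifted_factorial p p N)\<^sup>2)"
    by (simp only: Suc.IH)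
  also have "\<dots> = b ^ Suc N * (q_shifted_factorial (p / b) p (Suc N) / q_shifted_factorial p p (Suc N))\<^sup>2"
  proof -
    have 1: "1 - p / b * p ^ N = (b - ?a) / b"
      using b by (simp add: field_simps)
    have 2: "(1 - p * p ^ N)\<^sup>2 = (?a - 1)\<^sup>2"
      by (simp add: power2_commute)
    have 3: "?r = b * ((b - ?a) / b)\<^sup>2 / (?a - 1)\<^sup>2"
      using b by (simp add: power2_eq_square)
    show ?thesis
      unfolding qsf_Suc 1 power_divide power_mult_distrib 2 3 by (simp add: mult_ac)
  qed
  finally show ?case .
qed

text \<open>
  With \<open>u = p\<^bsup>k\<^esup>\<close>, the monomial \<open>u\<^sup>2\<close> is a combination of \<open>(1 - bu)(1 - cu)\<close>, \<open>(1 - bu)(1 - bpu)\<close> and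
  \<open>(1 - cu)(1 - cpu)\<close>; each of them shifts \<open>(b;p)\<^sub>k (c;p)\<^sub>k\<close> to a balanced pair of parameters.
\<close>

lemma sum_z3_eq_saalschuetz:
  fixes p b c :: "'a::field"
  assumes p: "p \<noteq> 0" and bc: "b \<noteq> 0" "c \<noteq> 0" "b * c * p = p ^ N"
    and ne: "c \<noteq> b" "p * c \<noteq> b" "c \<noteq> p * b"
  shows "(\<Sum>k\<le>N. q_shifted_factorial (1 / p ^ N) p k * q_shifted_factorial b p k *
      q_shifted_factorial c p k / q_shifted_factorial p p k ^ 3 * p ^ (3 * k)) =
    - (1 + p) / ((p * c - b) * (c - p * b)) * ((1 - b) * (1 - c)) * (\<Sum>k\<le>N. saalschuetz_term p (b * p) N k) +
    (1 - b) * (1 - b * p) / ((c - b) * (c - p * b)) * (\<Sum>k\<le>N. saalschuetz_term p (b * p * p) N k) +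
    (1 - c) * (1 - c * p) / ((c - b) * (p * c - b)) * (\<Sum>k\<le>N. saalschuetz_term p b N k)"
proof -
  let ?q = "\<lambda>x. q_shifted_factorial x p"
  have "?q (1 / p ^ N) k * ?q b k * ?q c k / ?q p k ^ 3 * p ^ (3 * k) =
    - (1 + p) / ((p * c - b) * (c - p * b)) * ((1 - b) * (1 - c)) * saalschuetz_term p (b * p) N k +
    (1 - b) * (1 - b * p) / ((c - b) * (c - p * b)) * saalschuetz_term p (b * p * p) N k +
    (1 - c) * (1 - c * p) / ((c - b) * (p * c - b)) * saalschuetz_term p b N k" for k
  proof -
    let ?u = "p ^ k" and ?X = "?q b k * ?q c k"
    let ?T = "\<lambda>x. ?q (1 / p ^ N) k / ?q p k ^ 3 * ?u * x"
    \<comment> \<open>Since \<open>b * c * p = p ^ N\<close>, the parameters balancing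
      \<open>b * p\<close>, \<open>b * p * p\<close> and \<open>b\<close> are \<open>c * p\<close>,
      \<open>c\<close> and \<open>c * p * p\<close>.\<close>
    have e: "p ^ (N + 1) / (b * p) = c * p" "p ^ (N + 1) / (b * p * p) = c"
        "p ^ (N + 1) / b = c * p * p"
      using bc p by (simp_all add: divide_simps flip: bc(3))
    have B1: "?q (b * p) k * (1 - b) = ?q b k * (1 - b * ?u)"
      and C1: "?q (c * p) k * (1 - c) = ?q c k * (1 - c * ?u)"
      by (rule qsf_shift)+
    have B2: "(1 - b) * (1 - b * p) * ?q (b * p * p) k = ?q b k * (1 - b * ?u) * (1 - b * p * ?u)"
    proof -
      have "(1 - b) * (1 - b * p) * ?q (b * p * p) k = (1 - b) * (?q (b * p * p) k * (1 - b * p))"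
        by (simp only: mult_ac)
      also have "\<dots> = (?q (b * p) k * (1 - b)) * (1 - b * p * ?u)"
        unfolding qsf_shift[of "b * p"] by (simp only: mult_ac)
      finally show ?thesis unfolding B1 .
    qed
    have C2: "(1 - c) * (1 - c * p) * ?q (c * p * p) k = ?q c k * (1 - c * ?u) * (1 - c * p * ?u)"
    proof -
      have "(1 - c) * (1 - c * p) * ?q (c * p * p) k = (1 - c) * (?q (c * p * p) k * (1 - c * p))"
        by (simp only: mult_ac)
      also have "\<dots> = (?q (c * p) k * (1 - c)) * (1 - c * p * ?u)"
        unfolding qsf_shift[of "c * p"] by (simp only: mult_ac)
      finally show ?thesis unfolding C1 .
    qed
    have t1: "(1 - b) * (1 - c) * saalschuetz_term p (b * p) N k = ?T (?X * ((1 - b * ?u) * (1 - c * ?u)))"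
    proof -
      have "(1 - b) * (1 - c) * saalschuetz_term p (b * p) N k =
          ?T ((?q (b * p) k * (1 - b)) * (?q (c * p) k * (1 - c)))"
        unfolding saalschuetz_term_def e by (simp add: mult_ac)
      then show ?thesis unfolding B1 C1 by (simp add: mult_ac)
    qed
    have t2: "(1 - b) * (1 - b * p) * saalschuetz_term p (b * p * p) N k =
        ?T (?X * ((1 - b * ?u) * (1 - b * p * ?u)))"
    proof -
      have "(1 - b) * (1 - b * p) * saalschuetz_term p (b * p * p) N k =
          ?T (((1 - b) * (1 - b * p) * ?q (b * p * p) k) * ?q c k)"
        unfolding saalschuetz_term_def e by (simp add: mult_ac)
      then show ?thesis unfolding B2 by (simp add: mult_ac)
    qed
    have t3: "(1 - c) * (1 - c * p) * saalschuetz_term p b N k =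
        ?T (?X * ((1 - c * ?u) * (1 - c * p * ?u)))"
    proof -
      have "(1 - c) * (1 - c * p) * saalschuetz_term p b N k =
          ?T (((1 - c) * (1 - c * p) * ?q (c * p * p) k) * ?q b k)"
        unfolding saalschuetz_term_def e by (simp add: mult_ac)
      then show ?thesis unfolding C2 by (simp add: mult_ac)
    qed
    have ne': "c - b \<noteq> 0" "p * c - b \<noteq> 0" "c - p * b \<noteq> 0" using ne by auto
    \<comment> \<open>The weights are those for which the constant and linear terms in
      \<open>?u\<close> cancel.\<close>
    have basis: "?u\<^sup>2 = - (1 + p) / ((p * c - b) * (c - p * b)) * ((1 - b * ?u) * (1 - c * ?u)) +
        1 / ((c - b) * (c - p * b)) * ((1 - b * ?u) * (1 - b * p * ?u)) +
        1 / ((c - b) * (p * c - b)) * ((1 - c * ?u) * (1 - c * p * ?u))"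
    proof -
      have "x\<^sup>2 * ((c - b) * (p * c - b) * (c - p * b)) = - (1 + p) * (c - b) * ((1 - b * x) * (1 - c * x)) +
        (p * c - b) * ((1 - b * x) * (1 - b * p * x)) + (c - p * b) * ((1 - c * x) * (1 - c * p * x))" for x
        by (simp add: power2_eq_square algebra_simps)
      then have "?u\<^sup>2 = (- (1 + p) * (c - b) * ((1 - b * ?u) * (1 - c * ?u)) +
        (p * c - b) * ((1 - b * ?u) * (1 - b * p * ?u)) + (c - p * b) * ((1 - c * ?u) * (1 - c * p * ?u)))
         / ((c - b) * (p * c - b) * (c - p * b))"
        using ne' by (simp add: eq_divide_eq)
      also have "\<dots> = - (1 + p) / ((p * c - b) * (c - p * b)) * ((1 - b * ?u) * (1 - c * ?u)) +
        1 / ((c - b) * (c - p * b)) * ((1 - b * ?u) * (1 - b * p * ?u)) +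
        1 / ((c - b) * (p * c - b)) * ((1 - c * ?u) * (1 - c * p * ?u))"
        using ne' by (simp add: add_divide_distrib)
      finally show ?thesis .
    qed
    have "?q (1 / p ^ N) k * ?q b k * ?q c k / ?q p k ^ 3 * p ^ (3 * k) = ?T (?X * ?u\<^sup>2)"
      by (simp add: power_mult power2_eq_square power3_eq_cube power_mult_distrib power_commutes mult.commute[of 3])
    also have "\<dots> = - (1 + p) / ((p * c - b) * (c - p * b)) * ?T (?X * ((1 - b * ?u) * (1 - c * ?u))) +
        1 / ((c - b) * (c - p * b)) * ?T (?X * ((1 - b * ?u) * (1 - b * p * ?u))) +
        1 / ((c - b) * (p * c - b)) * ?T (?X * ((1 - c * ?u) * (1 - c * p * ?u)))"
      by (subst basis) (simp only: distrib_left mult_ac)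
    finally show ?thesis
      unfolding t1[symmetric] t2[symmetric] t3[symmetric] by (simp add: mult.assoc)
  qed
  then show ?thesis
    by (simp add: sum.distrib sum_distrib_left)
qed

section \<open>The terminating q-binomial theorem and its orthogonality relation\<close>

lemma q_binomial_finite:
  fixes p :: "'a::field"
  assumes p: "p \<noteq> 0" "\<And>j. j > 0 \<Longrightarrow> p ^ j \<noteq> 1"
  shows "(\<Sum>k\<le>N. q_shifted_factorial (1 / p ^ N) p k / q_shifted_factorial p p k * x ^ k) =
    q_shifted_factorial (x / p ^ N) p N"
proof (induction N)
  case (Suc N)
  let ?A = "\<lambda>N k. q_shifted_factorial (1 / p ^ N) p k / q_shifted_factorial p p k"
  \<comment> \<open>A q-Pascal rule for the coefficients drives the induction.\<close>
  have rec: "?A (Suc N) (Suc k) = ?A N (Suc k) - ?A N k / p ^ Suc N" for k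
  proof -
    have "1 - p * p ^ k \<noteq> 0" using p(2)[of "Suc k"] by auto
    then show ?thesis
      using qsf_base_nonzero[OF p(2), of k] p(1)
      by (subst qsf_Suc'[of "1 / p ^ Suc N"]) (simp add: qsf_Suc divide_simps, simp add: algebra_simps)
  qed
  \<comment> \<open>The factor 1 - p^(-N) p^N is zero, so the sum for \<open>N\<close> may run up to
    \<open>Suc N\<close>.\<close>
  have last: "?A N (Suc N) = 0"
    using p(1) by (simp add: qsf_Suc)
  have "(\<Sum>k\<le>Suc N. ?A (Suc N) k * x ^ k) = 1 + (\<Sum>k\<le>N. ?A (Suc N) (Suc k) * x ^ Suc k)"
    by (subst sum.atMost_Suc_shift) simp
  also have "\<dots> = (1 + (\<Sum>k\<le>N. ?A N (Suc k) * x ^ Suc k)) - x / p ^ Suc N * (\<Sum>k\<le>N. ?A N k * x ^ k)"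
    unfolding rec by (simp add: left_diff_distrib right_diff_distrib sum_subtractf sum_distrib_left mult_ac)
  also have "1 + (\<Sum>k\<le>N. ?A N (Suc k) * x ^ Suc k) = (\<Sum>k\<le>Suc N. ?A N k * x ^ k)"
    by (subst sum.atMost_Suc_shift) simp
  also have "\<dots> = (\<Sum>k\<le>N. ?A N k * x ^ k)"
    by (simp only: sum.atMost_Suc last) simp
  finally have "(\<Sum>k\<le>Suc N. ?A (Suc N) k * x ^ k) = (1 - x / p ^ Suc N) * q_shifted_factorial (x / p ^ N) p N"
    unfolding Suc.IH by (simp add: algebra_simps)
  also have "\<dots> = q_shifted_factorial (x / p ^ Suc N) p (Suc N)"
    using p(1) by (subst qsf_Suc') simp
  finally show ?case .
qed simp

text \<open>For a monomial of degree \<open>i\<close> the sum is the q-binomial theorem at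
  \<open>x = p ^ Suc i\<close>, and the resulting product has a zero factor at index
  \<open>N - Suc i\<close>.\<close>

lemma q_binomial_orthogonality:
  fixes p :: "'a::field"
  assumes p: "p \<noteq> 0" "\<And>j. j > 0 \<Longrightarrow> p ^ j \<noteq> 1" and "degree f < N"
  shows "(\<Sum>k\<le>N. q_shifted_factorial (1 / p ^ N) p k / q_shifted_factorial p p k * p ^ k * poly f (p ^ k)) = 0"
proof -
  let ?A = "\<lambda>k. q_shifted_factorial (1 / p ^ N) p k / q_shifted_factorial p p k"
  have mono: "(\<Sum>k\<le>N. ?A k * (p ^ Suc i) ^ k) = 0" if "i < N" for i
  proof -
    have "p ^ Suc i / p ^ N * p ^ (N - Suc i) = 1"
      using p(1) that by (simp flip: power_Suc power_add)
    then have "q_shifted_factorial (p ^ Suc i / p ^ N) p N = 0"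
      unfolding q_shifted_factorial_def using that
      by (intro prod_zero bexI[of _ "N - Suc i"]) auto
    then show ?thesis
      using q_binomial_finite[OF p, of N "p ^ Suc i"] by simp
  qed
  have "(\<Sum>k\<le>N. ?A k * p ^ k * poly f (p ^ k)) =
      (\<Sum>k\<le>N. \<Sum>i\<le>degree f. coeff f i * (?A k * (p ^ Suc i) ^ k))"
    by (intro sum.cong refl)
      (simp add: poly_altdef sum_distrib_left sum_divide_distrib power_mult_distrib mult_ac flip: power_mult)
  also have "\<dots> = (\<Sum>i\<le>degree f. coeff f i * (\<Sum>k\<le>N. ?A k * (p ^ Suc i) ^ k))"
    by (subst sum.swap) (simp add: sum_distrib_left)
  also have "\<dots> = 0"
    by (rule sum.neutral) (use mono assms(3) in auto)
  finally show ?thesis .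
qed

text \<open>The quotient (p^(s+1);p)_k / (p;p)_k = (p^(k+1);p)_s / (p;p)_s is a polynomial of degree
  at most \<open>s\<close> in \<open>p ^ k\<close>. Two such quotients and two of the three factors
  \<open>p ^ k\<close> give degree at most \<open>2 * s + 2\<close>; the third is the weight in the
  orthogonality relation.\<close>

lemma sum_z3_integral_parameter_eq_0:
  fixes p :: "'a::field"
  assumes p: "p \<noteq> 0" "\<And>j. j > 0 \<Longrightarrow> p ^ j \<noteq> 1" and N: "2 * s + 2 < N"
  shows "(\<Sum>k\<le>N. q_shifted_factorial (1 / p ^ N) p k * q_shifted_factorial (p ^ Suc s) p k *
      q_shifted_factorial (p ^ Suc s) p k / q_shifted_factorial p p k ^ 3 * p ^ (3 * k)) = 0"
proof -
  let ?q = "\<lambda>x. q_shifted_factorial x p"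
  define g where "g = (\<Prod>j<s. [:1, - (p ^ Suc j):])"
  have g: "poly g (p ^ k) = ?q (p ^ Suc k) s" for k
    by (simp add: g_def poly_prod q_shifted_factorial_def mult_ac)
  have "degree [:1, c:] \<le> 1" for c :: 'a
    using degree_pCons_le[of 1 "[:c:]"] by simp
  then have "degree g \<le> (\<Sum>j<s. 1)"
    unfolding g_def by (intro order.trans[OF degree_prod_sum_le] sum_mono) (simp_all only: o_def finite_lessThan)
  then have dg: "degree g \<le> s" by simp
  have quot: "?q (p ^ Suc s) k = ?q p k * poly g (p ^ k) / ?q p s" for k
  proof -
    have "?q p s * ?q (p ^ Suc s) k = ?q p k * ?q (p ^ Suc k) s"
      using qsf_add[of p p s k] qsf_add[of p p k s] by (simp add: add.commute)
    then show ?thesis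
      using qsf_base_nonzero[OF p(2), of s] by (simp add: g divide_simps mult.commute)
  qed
  define f where "f = g * g * [:0, 0, 1:]"
  have "degree f \<le> degree g + degree g + 2"
    unfolding f_def by (intro order.trans[OF degree_mult_le] add_mono order.trans[OF degree_mult_le]) auto
  then have df: "degree f < N" using dg N by linarith
  have "(\<Sum>k\<le>N. ?q (1 / p ^ N) k * ?q (p ^ Suc s) k * ?q (p ^ Suc s) k / ?q p k ^ 3 * p ^ (3 * k)) =
      (\<Sum>k\<le>N. 1 / (?q p s)\<^sup>2 * (?q (1 / p ^ N) k / ?q p k * p ^ k * poly f (p ^ k)))"
  proof (intro sum.cong refl)
    fix k
    have "p ^ (3 * k) = p ^ k * (p ^ k * p ^ k)"
      by (simp add: mult_2 flip: power_add, simp add: numeral_3_eq_3)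
    then show "?q (1 / p ^ N) k * ?q (p ^ Suc s) k * ?q (p ^ Suc s) k / ?q p k ^ 3 * p ^ (3 * k) =
       1 / (?q p s)\<^sup>2 * (?q (1 / p ^ N) k / ?q p k * p ^ k * poly f (p ^ k))"
      using qsf_base_nonzero[OF p(2), of k]
      unfolding quot f_def by (simp add: power2_eq_square power3_eq_cube mult_ac)
  qed
  also have "\<dots> = 0"
    by (simp only: sum_distrib_left[symmetric] q_binomial_orthogonality[OF p df] mult_zero_right)
  finally show ?thesis .
qed

section \<open>Divisibility in the localization of the integer polynomials at the modulus\<close>

text \<open>This is the \<open>m\<close>-th power of the ideal generated by \<open>M\<close> in the
  localization at the denominators coprime to \<open>M\<close>; \<open>m = 0\<close> means
  integrality. The condition on \<open>g\<close> is separate because 0 is coprime to a unit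
  \<open>M\<close>.\<close>

definition locdvd :: "int poly \<Rightarrow> nat \<Rightarrow> ratfun \<Rightarrow> bool" where
  "locdvd M m x \<longleftrightarrow>
     (\<exists>f g. g \<noteq> 0 \<and> coprime g M \<and> x = to_fract (M ^ m * f) / to_fract g)"

lemma locdvdI:
  "g \<noteq> 0 \<Longrightarrow> coprime g M \<Longrightarrow> x = to_fract (M ^ m * f) / to_fract g \<Longrightarrow> locdvd M m x"
  unfolding locdvd_def by blast

lemma locdvdE:
  assumes "locdvd M m x"
  obtains f g where "g \<noteq> 0" "coprime g M" "x = to_fract (M ^ m * f) / to_fract g"
  using assms unfolding locdvd_def by blast

lemma locdvd_add:
  assumes "locdvd M m x" "locdvd M m y"
  shows "locdvd M m (x + y)"
proof -
  obtain f g where x: "g \<noteq> 0" "coprime g M" "x = to_fract (M ^ m * f) / to_fract g"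
    using assms(1) by (rule locdvdE)
  obtain f' g' where y: "g' \<noteq> 0" "coprime g' M" "y = to_fract (M ^ m * f') / to_fract g'"
    using assms(2) by (rule locdvdE)
  show ?thesis
  proof (rule locdvdI)
    show "x + y = to_fract (M ^ m * (f * g' + f' * g)) / to_fract (g * g')"
      using x y by (simp add: add_frac_eq algebra_simps)
  qed (use x y in auto)
qed

lemma locdvd_mult:
  assumes "locdvd M m x" "locdvd M k y"
  shows "locdvd M (m + k) (x * y)"
proof -
  obtain f g where x: "g \<noteq> 0" "coprime g M" "x = to_fract (M ^ m * f) / to_fract g"
    using assms(1) by (rule locdvdE)
  obtain f' g' where y: "g' \<noteq> 0" "coprime g' M" "y = to_fract (M ^ k * f') / to_fract g'"
    using assms(2) by (rule locdvdE)
  show ?thesis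
  proof (rule locdvdI)
    show "x * y = to_fract (M ^ (m + k) * (f * f')) / to_fract (g * g')"
      using x y by (simp add: power_add mult_ac)
  qed (use x y in auto)
qed

lemma locdvd_to_fract: "M ^ m dvd f \<Longrightarrow> locdvd M m (to_fract f)"
  by (auto elim!: dvdE intro!: locdvdI[of 1])

lemma locdvd_divide:
  assumes "locdvd M m x" "g \<noteq> 0" "coprime g M"
  shows "locdvd M m (x / to_fract g)"
  using locdvd_mult[OF assms(1), of 0 "1 / to_fract g"] locdvdI[of g M "1 / to_fract g" 0 1] assms
  by simp

lemma locdvd_mono:
  assumes "locdvd M m x" "k \<le> m"
  shows "locdvd M k x"
proof -
  obtain f g where x: "g \<noteq> 0" "coprime g M" "x = to_fract (M ^ m * f) / to_fract g"
    using assms(1) by (rule locdvdE)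
  have "M ^ m * f = M ^ k * (M ^ (m - k) * f)"
    using assms(2) by (simp flip: power_add mult.assoc)
  then show ?thesis
    using x by (intro locdvdI[of g M x k "M ^ (m - k) * f"]) (simp_all only: simp_thms)
qed

lemma locdvd_0 [simp]: "locdvd M m 0"
  using locdvd_to_fract[of M m 0] by simp

lemma locdvd_1 [simp]: "locdvd M 0 1"
  using locdvd_to_fract[of M 0 1] by simp

lemma locdvd_minus: "locdvd M m x \<Longrightarrow> locdvd M m (- x)"
  using locdvd_mult[of M 0 "- 1" m x] locdvd_to_fract[of M 0 "-1"] by simp

lemma locdvd_diff: "locdvd M m x \<Longrightarrow> locdvd M m y \<Longrightarrow> locdvd M m (x - y)"
  using locdvd_add[of M m x "- y"] locdvd_minus by simp

lemma locdvd_mult_left: "locdvd M 0 x \<Longrightarrow> locdvd M m y \<Longrightarrow> locdvd M m (x * y)"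
  using locdvd_mult[of M 0 x m y] by simp

lemma locdvd_mult_right: "locdvd M m x \<Longrightarrow> locdvd M 0 y \<Longrightarrow> locdvd M m (x * y)"
  using locdvd_mult[of M m x 0 y] by simp

lemma locdvd_numeral [simp]: "locdvd M 0 (numeral k)"
proof -
  have "to_fract (of_nat m) = (of_nat m :: ratfun)" for m
    by (induction m) simp_all
  then have "to_fract (numeral k) = (numeral k :: ratfun)"
    by (metis of_nat_numeral)
  then show ?thesis
    using locdvd_to_fract[of M 0 "numeral k"] by simp
qed

lemma locdvd_power: "locdvd M m x \<Longrightarrow> locdvd M (m * k) (x ^ k)"
  by (induction k) (auto dest: locdvd_mult)

lemma locdvd_power_0: "locdvd M 0 x \<Longrightarrow> locdvd M 0 (x ^ k)"
  using locdvd_power[of M 0 x k] by simp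

lemma locdvd_sum: "(\<And>i. i \<in> A \<Longrightarrow> locdvd M m (h i)) \<Longrightarrow> locdvd M m (sum h A)"
  by (induction A rule: infinite_finite_induct) (auto intro: locdvd_add)

lemma locdvd_prod: "(\<And>i. i \<in> A \<Longrightarrow> locdvd M 0 (h i)) \<Longrightarrow> locdvd M 0 (prod h A)"
  by (induction A rule: infinite_finite_induct) (auto intro: locdvd_mult_left)

lemmas locdvd_ring_intros = locdvd_add locdvd_diff locdvd_minus locdvd_power_0 locdvd_mult_left

text \<open>The reduced denominator divides every denominator of the same fraction, and coprimality
  to \<open>M\<close> passes to divisors.\<close>

lemma coprime_snd_quot_of_fract:
  assumes "locdvd M 0 x"
  shows "coprime (snd (quot_of_fract x)) M"
proof -
  obtain f g where x: "g \<noteq> 0" "coprime g M" "x = to_fract f / to_fract g"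
    using assms by (rule locdvdE) simp
  have "quot_of_fract x = normalize_quot (f, g)"
    using x quot_of_fract_quot_to_fract[of "(f, g)"] by (simp add: quot_to_fract_def Fract_conv_to_fract)
  then have "snd (quot_of_fract x) dvd g"
    using normalize_quotE[OF x(1), of f] by (metis dvd_triv_left)
  then show ?thesis
    using x(2) by (metis coprime_divisors dvd_refl)
qed

text \<open>After clearing denominators, \<open>M ^ m\<close> divides the reduced numerator times
  \<open>g\<close>, and it is coprime to \<open>g\<close>.\<close>

lemma dvd_fst_quot_of_fract:
  assumes "locdvd M m x"
  shows "M ^ m dvd fst (quot_of_fract x)"
proof -
  obtain f g where x: "g \<noteq> 0" "coprime g M" "x = to_fract (M ^ m * f) / to_fract g"
    using assms by (rule locdvdE)
  let ?a = "fst (quot_of_fract x)" and ?b = "snd (quot_of_fract x)"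
  have b: "?b \<noteq> 0"
    using quot_of_fract_in_normalized_fracts[of x] by (auto simp: normalized_fracts_def)
  have "x = to_fract ?a / to_fract ?b"
    using quot_to_fract_quot_of_fract[of x]
    by (simp add: quot_to_fract_def Fract_conv_to_fract case_prod_unfold)
  then have "to_fract (?a * g) = to_fract (M ^ m * f * ?b)"
    using x b by (simp add: frac_eq_eq)
  then have "?a * g = M ^ m * f * ?b"
    by (simp only: to_fract_eq_iff)
  then have "M ^ m dvd ?a * g"
    by (metis dvd_triv_left mult.assoc)
  moreover have "coprime (M ^ m) g"
    using x(2) by (simp add: coprime_commute)
  ultimately show ?thesis
    by (simp add: coprime_dvd_mult_left_iff)
qed

lemma ratfun_congI:
  assumes "locdvd M 0 A" "locdvd M 0 B" "locdvd M m (A - B)"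
  shows "ratfun_cong A B (M ^ m)"
  unfolding ratfun_cong_def
  using coprime_snd_quot_of_fract[OF assms(1)] coprime_snd_quot_of_fract[OF assms(2)]
    dvd_fst_quot_of_fract[OF assms(3)] by simp

section \<open>Cyclotomic polynomials over the integers\<close>

lemma lead_coeff_cyclotomic:
  assumes "n > 0"
  shows "lead_coeff (cyclotomic n) = 1"
proof -
  have "lead_coeff (map_poly complex_of_int (cyclotomic n)) = 1"
    unfolding map_poly_cyclotomic[OF assms] by (simp add: lead_coeff_prod)
  then show ?thesis
    by (simp add: degree_map_poly_complex_of_int coeff_map_poly)
qed

text \<open>Over the complex numbers it is one factor of the product over the divisors of
  \<open>n\<close>; the cofactor is integral because the cyclotomic polynomial is monic.\<close>

lemma cyclotomic_dvd:
  assumes "n > 0"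
  shows "cyclotomic n dvd 1 - monom 1 n"
proof -
  let ?i = "map_poly complex_of_int"
  have i: "?i (1 - monom 1 n) = 1 - monom 1 n"
    by (rule poly_eqI) (simp add: coeff_map_poly)
  have "?i (cyclotomic n) dvd monom 1 n - 1"
    unfolding map_poly_cyclotomic[OF assms] prod_totatives_divisors[OF assms, symmetric]
    using assms by (intro dvd_prodI) auto
  then have "?i (cyclotomic n) dvd ?i (1 - monom 1 n)"
    unfolding i by (metis dvd_minus_iff minus_diff_eq)
  then obtain h where h: "?i (1 - monom 1 n) = ?i (cyclotomic n) * h"
    by (elim dvdE)
  then obtain p where "?i p = h"
    using monic_int_poly_divide lead_coeff_cyclotomic[OF assms] by blast
  then have "?i (1 - monom 1 n) = ?i (cyclotomic n * p)"
    using h by (simp only: map_poly_complex_of_int_mult)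
  then have "1 - monom 1 n = cyclotomic n * p"
    by (simp only: map_poly_complex_of_int_inj)
  then show ?thesis by simp
qed

text \<open>A root is cis(2 pi k / n) with \<open>k\<close> coprime to \<open>n\<close>, so
  \<open>z ^ m = 1\<close> makes \<open>m * k\<close> a multiple of \<open>n\<close>.\<close>

lemma root_cyclotomic_power_eq_1_imp_dvd:
  assumes "n > 0" "poly (map_poly complex_of_int (cyclotomic n)) z = 0" "z ^ m = 1"
  shows "n dvd m"
proof -
  obtain k where k: "k \<in> totatives n" "z = cis (2 * pi * real k / real n)"
    using assms(2) unfolding map_poly_cyclotomic[OF assms(1)] by (auto simp: poly_prod)
  have "cis (real m * (2 * pi * real k / real n)) = 1"
    using assms(3) k(2) by (simp add: DeMoivre)
  then have "cos (real m * (2 * pi * real k / real n)) = 1"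
    by (metis cis.simps(1) one_complex.simps(1))
  then obtain j :: int where "real m * (2 * pi * real k / real n) = real_of_int j * 2 * pi"
    unfolding cos_one_2pi_int by blast
  then have "real m * real k = j * real n"
    using assms(1) by (simp add: field_simps)
  then have "real_of_int (int (m * k)) = real_of_int (j * int n)"
    by simp
  then have "int (m * k) = j * int n"
    by (simp only: of_int_eq_iff)
  then have "int n dvd int (m * k)"
    by simp
  then have "n dvd m * k"
    by (simp only: of_nat_dvd_iff)
  moreover have "coprime n k"
    using k(1) by (simp add: in_totatives_iff coprime_commute)
  ultimately show ?thesis
    by (simp add: coprime_dvd_mult_left_iff)
qed

text \<open>A nonconstant common divisor would have a complex root, contradicting the previous
  lemma; a constant one divides the leading coefficient 1.\<close>

lemma coprime_one_minus_monom_cyclotomic: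
  assumes "n > 0" "\<not> n dvd m"
  shows "coprime (1 - monom 1 m) (cyclotomic n)"
proof (rule coprimeI)
  fix d assume d: "d dvd 1 - monom 1 m" "d dvd cyclotomic n"
  let ?i = "map_poly complex_of_int"
  have "degree d = 0"
  proof (rule ccontr)
    assume "degree d \<noteq> 0"
    then have "degree (?i d) \<noteq> 0" by (simp add: degree_map_poly_complex_of_int)
    then obtain z where z: "poly (?i d) z = 0"
      by (metis fundamental_theorem_of_algebra constant_degree)
    have "?i d dvd ?i (1 - monom 1 m)" "?i d dvd ?i (cyclotomic n)"
      using d by (auto elim!: dvdE simp: map_poly_complex_of_int_mult)
    then have "poly (?i (1 - monom 1 m)) z = 0" and r: "poly (?i (cyclotomic n)) z = 0"
      using z by (auto elim!: dvdE)
    moreover have "?i (1 - monom 1 m) = 1 - monom 1 m"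
      by (rule poly_eqI) (simp add: coeff_map_poly)
    ultimately have "z ^ m = 1"
      by (simp add: poly_monom)
    then show False
      using root_cyclotomic_power_eq_1_imp_dvd[OF assms(1) r] assms(2) by blast
  qed
  then obtain c where c: "d = [:c:]"
    using degree_eq_zeroE by blast
  then have "c dvd lead_coeff (cyclotomic n)"
    using d(2) by (simp add: const_poly_dvd_iff)
  then show "is_unit d"
    using lead_coeff_cyclotomic[OF assms(1)] c by (simp add: is_unit_const_poly_iff)
qed

section \<open>Powers of q in the localization\<close>

lemma qvar_power: "qvar ^ m = to_fract (monom 1 m)"
proof -
  have q: "qvar = to_fract (monom 1 1)"
    by (simp add: qvar_def to_fract_def monom_Suc one_pCons monom_0)
  show ?thesis
  proof (induction m)
    case (Suc m)
    have "qvar ^ Suc m = to_fract (monom 1 1) * to_fract (monom 1 m)"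
      by (simp only: power_Suc Suc.IH q[symmetric])
    also have "\<dots> = to_fract (monom 1 (Suc m))"
      by (simp only: to_fract_mult[symmetric] mult_monom) simp
    finally show ?case .
  qed simp
qed

lemma one_minus_qvar_power: "1 - qvar ^ m = to_fract (1 - monom 1 m)"
  by (simp add: qvar_power)

lemma qvar_nonzero [simp]: "qvar \<noteq> 0"
  by (simp add: qvar_def Zero_fract_def eq_fract)

lemma qvar_power_eq_1_iff [simp]: "qvar ^ m = 1 \<longleftrightarrow> m = 0"
proof -
  have "qvar ^ m = 1 \<longleftrightarrow> monom 1 m = (monom 1 0 :: int poly)"
    unfolding qvar_power by (metis monom_eq_1 to_fract_1 to_fract_eq_iff)
  then show ?thesis by (metis monom_eq_1_iff monom_eq_1)
qed

lemma locdvd_qvar_power [simp]: "locdvd M 0 (qvar ^ m)"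
  unfolding qvar_power by (rule locdvd_to_fract) simp

lemma locdvd_one_minus_qvar:
  assumes "n > 0" "n dvd m"
  shows "locdvd (cyclotomic n) 1 (1 - qvar ^ m)"
proof -
  obtain j where j: "m = n * j" using assms(2) by (elim dvdE)
  have "cyclotomic n dvd 1 - monom 1 n" by (rule cyclotomic_dvd[OF assms(1)])
  also have "1 - monom 1 n dvd (1 - monom 1 n ^ j :: int poly)"
    by (simp only: one_diff_power_eq dvd_triv_left)
  also have "monom 1 n ^ j = (monom 1 m :: int poly)"
    by (simp add: j monom_power)
  finally show ?thesis
    unfolding one_minus_qvar_power by (intro locdvd_to_fract) simp
qed

lemma locdvd_divide_one_minus_qvar:
  assumes "n > 0" "\<not> n dvd m" "locdvd (cyclotomic n) k x"
  shows "locdvd (cyclotomic n) k (x / (1 - qvar ^ m))"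
  unfolding one_minus_qvar_power
proof (rule locdvd_divide)
  have "m \<noteq> 0" using assms(2) by (metis dvd_0_right)
  then show "1 - monom 1 m \<noteq> (0 :: int poly)"
    using monom_eq_1_iff[of 1 m] by auto
qed (use assms coprime_one_minus_monom_cyclotomic in auto)

text \<open>Powers of q are units there: \<open>cyclotomic n\<close> divides 1 - q^n, which is
  coprime to q.\<close>

lemma locdvd_divide_qvar_power:
  assumes "n > 0" "locdvd (cyclotomic n) k x"
  shows "locdvd (cyclotomic n) k (x / qvar ^ m)"
  unfolding qvar_power
proof (rule locdvd_divide)
  have "coprime (monom 1 1) (1 - monom 1 n :: int poly)"
  proof (rule coprimeI)
    fix d :: "int poly" assume d: "d dvd monom 1 1" "d dvd 1 - monom 1 n"
    have "monom 1 1 dvd (monom 1 1 ^ n :: int poly)"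
      using assms(1) by (intro dvd_power) simp
    also have "monom 1 1 ^ n = (monom 1 n :: int poly)"
      by (simp add: monom_power)
    finally have "d dvd (1 - monom 1 n) + monom 1 n"
      using d by (intro dvd_add) (auto intro: dvd_trans)
    then show "is_unit d" by simp
  qed
  then have "coprime (monom 1 1) (cyclotomic n)"
    by (rule coprime_divisors[OF dvd_refl cyclotomic_dvd[OF assms(1)]])
  then show "coprime (monom 1 m) (cyclotomic n)"
    using coprime_power_left_iff[of "monom 1 1" m "cyclotomic n"] by (simp add: monom_power)
qed (use assms in auto)

section \<open>Quadratic dependence on the exponent\<close>

text \<open>
  Here \<open>f0\<close>, \<open>f1\<close>, \<open>f2\<close>, \<open>g\<close> are the values at \<open>\<alpha> = 0, 1, 2, -2\<close> of a function which modulo \<open>M\<^sup>3\<close> is a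
  quadratic polynomial in \<open>\<alpha>\<close> whose coefficient of degree \<open>i\<close> is divisible by \<open>M\<^sup>i\<close>.  It is
  expressed by Newton differences, which avoids dividing by \<open>2\<close>.
\<close>

definition quad_family :: "int poly \<Rightarrow> ratfun \<Rightarrow> ratfun \<Rightarrow> ratfun \<Rightarrow> ratfun \<Rightarrow> bool" where
  "quad_family M f0 f1 f2 g \<longleftrightarrow> locdvd M 0 f0 \<and> locdvd M 1 (f1 - f0) \<and>
     locdvd M 2 (f2 - 2 * f1 + f0) \<and>
     locdvd M 3 (g - (f0 - 2 * (f1 - f0) + 3 * (f2 - 2 * f1 + f0)))"

lemma quad_familyE:
  assumes "quad_family M f0 f1 f2 g"
  obtains y z e where "locdvd M 0 f0" "locdvd M 1 y" "locdvd M 2 z" "locdvd M 3 e"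
    "f1 = f0 + y" "f2 = f0 + 2 * y + z" "g = f0 - 2 * y + 3 * z + e"
  using assms that[of "f1 - f0" "f2 - 2 * f1 + f0" "g - (f0 - 2 * (f1 - f0) + 3 * (f2 - 2 * f1 + f0))"]
  unfolding quad_family_def by (simp add: algebra_simps)

lemma locdvd_3_products:
  assumes "locdvd M 1 y" "locdvd M 1 y'" "locdvd M 1 y''" "locdvd M 2 z" "locdvd M 2 z'"
  shows "locdvd M 3 (y * z)" "locdvd M 3 (z * y)" "locdvd M 3 (z * z')" "locdvd M 3 (y * y' * y'')"
    "locdvd M 2 (y * y')"
proof -
  show "locdvd M 3 (y * z)" "locdvd M 3 (z * y)"
    using locdvd_mult[OF assms(1,4)] locdvd_mult[OF assms(4,1)] by (simp_all add: numeral_3_eq_3)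
  show "locdvd M 3 (z * z')"
    using locdvd_mult[OF assms(4,5)] by (rule locdvd_mono) simp
  show "locdvd M 3 (y * y' * y'')" "locdvd M 2 (y * y')"
    using locdvd_mult[OF locdvd_mult[OF assms(1,2)] assms(3)] locdvd_mult[OF assms(1,2)]
    by (simp_all add: numeral_3_eq_3 numeral_2_eq_2)
qed

text \<open>A second difference times any difference of the other factor lies in M^3. The product
  \<open>y * y'\<close> enters the first difference once and the second twice, which at -2 gives the
  correct weight -2 + 3 * 2 = (-2)^2.\<close>

lemma quad_family_mult:
  assumes "quad_family M f0 f1 f2 g" "quad_family M f0' f1' f2' g'"
  shows "quad_family M (f0 * f0') (f1 * f1') (f2 * f2') (g * g')"
proof -
  obtain y z e where A: "locdvd M 0 f0" "locdvd M 1 y" "locdvd M 2 z" "locdvd M 3 e"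
    "f1 = f0 + y" "f2 = f0 + 2 * y + z" "g = f0 - 2 * y + 3 * z + e"
    using assms(1) by (rule quad_familyE)
  obtain y' z' e' where B: "locdvd M 0 f0'" "locdvd M 1 y'" "locdvd M 2 z'" "locdvd M 3 e'"
    "f1' = f0' + y'" "f2' = f0' + 2 * y' + z'" "g' = f0' - 2 * y' + 3 * z' + e'"
    using assms(2) by (rule quad_familyE)
  define yy yz zy zz where defs: "yy = y * y'" "yz = y * z'" "zy = z * y'" "zz = z * z'"
  have low: "locdvd M 0 (f0 - 2 * y + 3 * z)" "locdvd M 0 (f0' - 2 * y' + 3 * z' + e')"
    using A(1) B(1) locdvd_mono[OF A(2)] locdvd_mono[OF A(3)]
      locdvd_mono[OF B(2)] locdvd_mono[OF B(3)] locdvd_mono[OF B(4)]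
    by (intro locdvd_ring_intros locdvd_numeral; simp)+
  have high: "locdvd M 2 yy" "locdvd M 3 yz" "locdvd M 3 zy" "locdvd M 3 zz"
    unfolding defs
    using locdvd_3_products[OF A(2) B(2) B(2) A(3) B(3)] locdvd_3_products[OF A(2) B(2) B(2) B(3) B(3)]
        locdvd_3_products[OF B(2) B(2) B(2) A(3) B(3)] by simp_all
  then have high': "locdvd M 1 yy" "locdvd M 2 yz" "locdvd M 2 zy" "locdvd M 2 zz"
    by (auto elim: locdvd_mono)
  have 1: "f1 * f1' - f0 * f0' = f0 * y' + f0' * y + yy"
    by (simp add: A B defs algebra_simps)
  have 2: "f2 * f2' - 2 * (f1 * f1') + f0 * f0' = f0 * z' + f0' * z + 2 * yy + 2 * yz + 2 * zy + zz"
    by (simp add: A B defs algebra_simps)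
  have 3: "g * g' - (f0 * f0' - 2 * (f0 * y' + f0' * y + yy) +
      3 * (f0 * z' + f0' * z + 2 * yy + 2 * yz + 2 * zy + zz)) =
      6 * zz - 12 * yz - 12 * zy + (f0' - 2 * y' + 3 * z' + e') * e + (f0 - 2 * y + 3 * z) * e'"
    by (simp add: A B defs algebra_simps)
  have "locdvd M 0 (f0 * f0')" "locdvd M 1 (f0 * y' + f0' * y + yy)"
    "locdvd M 2 (f0 * z' + f0' * z + 2 * yy + 2 * yz + 2 * zy + zz)"
    "locdvd M 3 (6 * zz - 12 * yz - 12 * zy + (f0' - 2 * y' + 3 * z' + e') * e + (f0 - 2 * y + 3 * z) * e')"
    by (intro locdvd_add locdvd_diff locdvd_mult_left high high' low A(1-4) B(1-4) locdvd_numeral)+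
  then show ?thesis
    unfolding quad_family_def 2 1 3 by blast
qed

text \<open>The weights 4 and -3 add up to 1, the triples (-2, 1, 1) and (-2, 0, 2) both sum to 0,
  and their sums of squares 6 and 8 satisfy 4 * 6 = 3 * 8. Hence all contributions of orders one and
  two cancel.\<close>

lemma quad_family_cube:
  assumes "quad_family M f0 f1 f2 g"
  shows "locdvd M 3 (f0 ^ 3 - (4 * (g * f1 * f1) - 3 * (g * f0 * f2)))"
proof -
  obtain y z e where A: "locdvd M 0 f0" "locdvd M 1 y" "locdvd M 2 z" "locdvd M 3 e"
    "f1 = f0 + y" "f2 = f0 + 2 * y + z" "g = f0 - 2 * y + 3 * z + e"
    using assms by (rule quad_familyE)
  define yyy yz zz where defs: "yyy = y * y * y" "yz = y * z" "zz = z * z"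
  have low: "locdvd M 0 y" "locdvd M 0 z"
    using locdvd_mono[OF A(2)] locdvd_mono[OF A(3)] by simp_all
  have high: "locdvd M 3 yyy" "locdvd M 3 yz" "locdvd M 3 zz"
    unfolding defs by (rule locdvd_3_products[OF A(2) A(2) A(2) A(3) A(3)])+
  have "f0 ^ 3 - (4 * (g * f1 * f1) - 3 * (g * f0 * f2)) =
      8 * yyy - (12 * f0) * yz - (12 * y) * yz + (9 * f0) * zz
      - (f0 * f0 + 2 * f0 * y + 4 * y * y - 3 * f0 * z) * e"
    by (simp add: A defs power3_eq_cube algebra_simps)
  then show ?thesis
    by (simp only:) (intro locdvd_add locdvd_diff locdvd_mult_left locdvd_numeral low high A(1-4))
qed

text \<open>The weights 1, -2, 3 are the binomial coefficients in the expansion of t^(-2) at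
  \<open>t = 1\<close>, whose remainder after the quadratic term is (1 - t)^3 (1 + 3t) /
  t^2.\<close>

lemma quad_family_linear:
  assumes c: "locdvd M 0 c" and t: "locdvd M 0 t" "locdvd M 1 (1 - t)" "locdvd M 0 (1 / t\<^sup>2)" "t \<noteq> 0"
  shows "quad_family M (1 - c) (1 - c * t) (1 - c * t\<^sup>2) (1 - c / t\<^sup>2)"
proof -
  have 1: "(1 - c * t) - (1 - c) = c * (1 - t)" by (simp add: algebra_simps)
  have 2: "(1 - c * t\<^sup>2) - 2 * (1 - c * t) + (1 - c) = - (c * ((1 - t) * (1 - t)))"
    by (simp add: algebra_simps power2_eq_square)
  have 3: "(1 - c / t\<^sup>2) - ((1 - c) - 2 * (c * (1 - t)) + 3 * - (c * ((1 - t) * (1 - t)))) =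
     - (c * (1 / t\<^sup>2) * (1 + 3 * t)) * ((1 - t) * (1 - t) * (1 - t))"
    using t(4) by (simp add: power2_eq_square divide_simps) (simp add: algebra_simps)
  have "locdvd M 2 ((1 - t) * (1 - t))" "locdvd M 3 ((1 - t) * (1 - t) * (1 - t))"
    using locdvd_3_products(5)[OF t(2) t(2) t(2) locdvd_0 locdvd_0]
      locdvd_3_products(4)[OF t(2) t(2) t(2) locdvd_0 locdvd_0] by auto
  moreover have "locdvd M 0 (1 - c)" "locdvd M 0 (- (c * (1 / t\<^sup>2) * (1 + 3 * t)))"
    by (intro locdvd_ring_intros locdvd_numeral c t locdvd_1)+
  ultimately show ?thesis
    unfolding quad_family_def 2 1 3
    using locdvd_mult_left[OF c t(2)] locdvd_mult_left[OF c] locdvd_minus locdvd_mult_left by blast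
qed

lemma quad_family_qsf:
  assumes c: "locdvd M 0 c" and p: "locdvd M 0 p"
    and t: "locdvd M 0 t" "locdvd M 1 (1 - t)" "locdvd M 0 (1 / t\<^sup>2)" "t \<noteq> 0"
  shows "quad_family M (q_shifted_factorial c p k) (q_shifted_factorial (c * t) p k)
    (q_shifted_factorial (c * t\<^sup>2) p k) (q_shifted_factorial (c / t\<^sup>2) p k)"
proof (induction k)
  case 0
  show ?case by (simp add: quad_family_def)
next
  case (Suc k)
  have "locdvd M 0 (c * p ^ k)" using c p by (intro locdvd_ring_intros)
  from quad_family_linear[OF this t] show ?case
    unfolding qsf_Suc by (intro quad_family_mult Suc.IH) (simp add: mult_ac)
qed


section \<open>The congruence\<close>

text \<open>This is the cofactor in \<open>residual_poly_identity\<close>; later only its being an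
  integer polynomial in \<open>q\<close> and \<open>Q\<close> matters.\<close>

definition residual :: "'a::field \<Rightarrow> 'a \<Rightarrow> 'a" where
  "residual q Q = - (q ^ 6) +
       (3 * q ^ 4 + 3 * q ^ 5 - 5 * q ^ 6 + 3 * q ^ 8 + q ^ 9) * Q +
       (1 - 3 * q - 3 * q ^ 2 + 3 * q ^ 3 - q ^ 6 - 6 * q ^ 7 - 3 * q ^ 8 + 5 * q ^ 9 - 3 * q ^ 11) * Q ^ 2 +
       (2 - 3 * q ^ 2 + 6 * q ^ 4 + 3 * q ^ 5 - 2 * q ^ 6 + q ^ 9 + 3 * q ^ 10) * Q ^ 3 +
       (- 3 * q ^ 3 + 3 * q ^ 5 - q ^ 6 - 3 * q ^ 7 - q ^ 9) * Q ^ 4 +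
       q ^ 6 * Q ^ 5"

text \<open>The left-hand side is the common numerator of the three evaluated balanced sums minus
  \<open>3 * (1 + q)\<close>. Of its double zero at \<open>Q = 1\<close>, one factor cancels the
  pole from \<open>c - b\<close>; the other is divisible by the modulus at
  \<open>Q = q ^ (2 * n)\<close>.\<close>

lemma residual_poly_identity:
  fixes q Q :: "'a::field"
  shows "- (1 + q ^ 3) * (q - 1) * (q - Q) ^ 3 * (Q - 1) * Q * (1 - q)\<^sup>2 +
      (q - 1) ^ 3 * (1 - q\<^sup>2) ^ 3 * Q\<^sup>2 * (q ^ 3 * Q - 1) +
      (q - Q) ^ 3 * (1 - Q * q\<^sup>2) ^ 3 * (Q - q ^ 3) -
      3 * (1 + q) * ((Q - 1) * (q - Q)\<^sup>2 * (Q - q ^ 3) * (q ^ 3 * Q - 1) * Q * (1 - q)\<^sup>2) =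
    (Q - 1)\<^sup>2 * residual q Q"
  unfolding residual_def by algebra

lemma residual_identity:
  fixes q Q :: "'a::field"
  assumes "q \<noteq> 0" "Q \<noteq> 0" "q \<noteq> 1" "Q \<noteq> 1" "q \<noteq> Q" "Q \<noteq> q ^ 3" "q ^ 3 * Q \<noteq> 1"
  defines "b \<equiv> 1 / q" and "c \<equiv> Q / q"
  shows "- (1 + q ^ 3) / ((q ^ 3 * c - b) * (c - q ^ 3 * b)) * ((1 - b) * (1 - c)) +
      (1 - b) * (1 - b * q ^ 3) / ((c - b) * (c - q ^ 3 * b)) * (q * Q * ((1 - 1 / q\<^sup>2) / (1 - Q / q))\<^sup>2) +
      (1 - c) * (1 - c * q ^ 3) / ((c - b) * (q ^ 3 * c - b)) * (1 / (q * Q) * ((1 - Q * q\<^sup>2) / (1 - q))\<^sup>2) =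
    3 * (1 + q) + (Q - 1) * residual q Q / ((q - Q)\<^sup>2 * (Q - q ^ 3) * (q ^ 3 * Q - 1) * Q * (1 - q)\<^sup>2)"
proof -
  have ne: "Q - 1 \<noteq> 0" "1 - q \<noteq> 0" "q - Q \<noteq> 0" "Q - q ^ 3 \<noteq> 0" "q ^ 3 * Q - 1 \<noteq> 0"
    using assms by auto
  have s: "q ^ 3 * c - b = (q ^ 3 * Q - 1) / q" "c - q ^ 3 * b = (Q - q ^ 3) / q" "1 - b = (q - 1) / q"
    "1 - c = (q - Q) / q" "1 - b * q ^ 3 = 1 - q\<^sup>2" "1 - c * q ^ 3 = 1 - Q * q\<^sup>2" "c - b = (Q - 1) / q"
    "1 - 1 / q\<^sup>2 = - (1 - q\<^sup>2) / q\<^sup>2" "1 - Q / q = (q - Q) / q"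
    using assms(1) unfolding b_def c_def
    by (simp_all add: field_simps power2_eq_square power3_eq_cube)
  let ?E = "(Q - 1) * (q - Q)\<^sup>2 * (Q - q ^ 3) * (q ^ 3 * Q - 1) * Q * (1 - q)\<^sup>2"
  have 1: "- (1 + q ^ 3) / ((q ^ 3 * c - b) * (c - q ^ 3 * b)) * ((1 - b) * (1 - c)) =
      (- (1 + q ^ 3) * (q - 1) * (q - Q) ^ 3 * (Q - 1) * Q * (1 - q)\<^sup>2) / ?E"
    unfolding s using ne assms(1,2) by (simp add: divide_simps) (simp add: power2_eq_square power3_eq_cube)
  have 2: "(1 - b) * (1 - b * q ^ 3) / ((c - b) * (c - q ^ 3 * b)) * (q * Q * ((1 - 1 / q\<^sup>2) / (1 - Q / q))\<^sup>2) =
      ((q - 1) ^ 3 * (1 - q\<^sup>2) ^ 3 * Q\<^sup>2 * (q ^ 3 * Q - 1)) / ?E"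
  proof -
    have "(1 - b) * (1 - b * q ^ 3) / ((c - b) * (c - q ^ 3 * b)) * (q * Q * ((1 - 1 / q\<^sup>2) / (1 - Q / q))\<^sup>2) =
        (q - 1) * (1 - q\<^sup>2) ^ 3 * Q / ((Q - 1) * (q - Q)\<^sup>2 * (Q - q ^ 3))"
      unfolding s power_divide power2_minus using ne assms(1,2)
      by (simp add: divide_simps) (simp add: power2_eq_square power3_eq_cube power4_eq_xxxx)
    also have "\<dots> = ((q - 1) ^ 3 * (1 - q\<^sup>2) ^ 3 * Q\<^sup>2 * (q ^ 3 * Q - 1)) / ?E"
    proof -
      have "(q - 1) ^ 3 = (q - 1) * (1 - q)\<^sup>2" by (simp add: power2_eq_square power3_eq_cube algebra_simps)
      then show ?thesis using ne assms(1,2) by (simp add: power2_eq_square mult_ac)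
    qed
    finally show ?thesis .
  qed
  have 3: "(1 - c) * (1 - c * q ^ 3) / ((c - b) * (q ^ 3 * c - b)) * (1 / (q * Q) * ((1 - Q * q\<^sup>2) / (1 - q))\<^sup>2) =
      ((q - Q) ^ 3 * (1 - Q * q\<^sup>2) ^ 3 * (Q - q ^ 3)) / ?E"
    unfolding s using ne assms(1,2) by (simp add: divide_simps) (simp add: power2_eq_square power3_eq_cube)
  have 4: "3 * (1 + q) = (3 * (1 + q) * ?E) / ?E"
    using ne assms(2) by simp
  have 5: "(Q - 1) * residual q Q / ((q - Q)\<^sup>2 * (Q - q ^ 3) * (q ^ 3 * Q - 1) * Q * (1 - q)\<^sup>2) =
      (Q - 1)\<^sup>2 * residual q Q / ?E"
    using ne assms(2) by (simp add: power2_eq_square)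
  show ?thesis
    unfolding 1 2 3 5
    by (subst 4, unfold add_divide_distrib[symmetric])
      (use residual_poly_identity[of q Q] in \<open>simp only: diff_eq_eq add.commute\<close>)
qed

lemma qvar_power_eq_iff [simp]: "qvar ^ a = qvar ^ b \<longleftrightarrow> a = b"
  unfolding qvar_power by (simp add: monom_eq_iff')

section \<open>Specialization to n = 3r + 1 and N = 2r + 1\<close>

locale cyclotomic_setup =
  fixes n r N :: nat
  assumes r: "r > 0" and n: "n = 3 * r + 1" and N: "N = 2 * r + 1"
begin

abbreviation "q \<equiv> qvar"
abbreviation "Phi \<equiv> cyclotomic n"
abbreviation "p \<equiv> q ^ 3"
abbreviation "poch \<equiv> q_shifted_factorial"

lemma n_pos: "n > 0" and n_gt: "n > 3"
  using n r by auto

text \<open>Here \<open>3 * Suc j\<close> is at most \<open>2 * n + 1 < 3 * n\<close>, while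
  \<open>n\<close> and \<open>2 * n\<close> are 1 and 2 modulo 3. Thus (p;p)_k is coprime to
  \<open>Phi\<close> for k \<le> N.\<close>

lemma not_dvd_3: "\<not> n dvd 3 * Suc j" if "j < N"
proof
  assume "n dvd 3 * Suc j"
  then obtain k where k: "3 * Suc j = n * k" by (elim dvdE)
  have "k < 3"
  proof (rule ccontr)
    assume "\<not> k < 3"
    then have "n * 3 \<le> n * k" by simp
    then show False using k that n N r by simp
  qed
  then consider "k = 0" | "k = 1" | "k = 2" by linarith
  then have "3 * Suc j = 0 \<or> 3 * Suc j = 3 * r + 1 \<or> 3 * Suc j = 6 * r + 2"
    using k n by cases simp_all
  then show False by presburger
qed

lemma not_dvd_between: "\<not> n dvd m" if "n < m" "m < 2 * n"
proof
  assume "n dvd m"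
  then obtain k where k: "m = n * k" by (elim dvdE)
  then have "1 < k" "k < 2" using that by auto
  then show False by simp
qed

lemma not_dvd_small: "\<not> n dvd m" if "0 < m" "m < n"
  using that by (simp add: nat_dvd_not_less)

lemma not_dvd_2n_plus_3: "\<not> n dvd 2 * n + 3"
  using not_dvd_small[of 3] n_gt by (simp add: dvd_add_right_iff)

lemma locdvd_q [simp]: "locdvd Phi 0 q"
  using locdvd_qvar_power[of Phi 1] by simp

lemma p_powers: "p \<noteq> 0" "\<And>j. j > 0 \<Longrightarrow> p ^ j \<noteq> 1" "inj ((^) p)"
  by (auto simp: inj_def simp flip: power_mult)

lemma q_n: "q ^ n = q * p ^ r"
  by (simp add: n power_mult)

lemma p_N: "p ^ N = q * q ^ (2 * n)"
proof -
  have "3 * N = Suc (2 * n)" by (simp add: n N)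
  then show ?thesis
    by (simp only: power_mult[symmetric] power_Suc)
qed

lemma locdvd_divide_poch: "locdvd Phi m x \<Longrightarrow> k \<le> N \<Longrightarrow> locdvd Phi m (x / poch p p k)"
proof (induction k)
  case (Suc k)
  have "locdvd Phi m (x / poch p p k / (1 - q ^ (3 * Suc k)))"
    using Suc by (intro locdvd_divide_one_minus_qvar n_pos not_dvd_3) auto
  then show ?case
    by (simp add: qsf_Suc power_mult power_add)
qed simp

lemma locdvd_divide_poch_power: "locdvd Phi m x \<Longrightarrow> k \<le> N \<Longrightarrow> locdvd Phi m (x / poch p p k ^ i)"
proof (induction i)
  case (Suc i)
  then have "locdvd Phi m (x / poch p p k ^ i / poch p p k)"
    by (intro locdvd_divide_poch) auto
  then show ?case by (simp add: mult.commute)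
qed simp

text \<open>The factor with index \<open>r < N\<close> is 1 - q^n.\<close>

lemma locdvd_poch_N: "locdvd Phi 1 (poch q p N)"
proof -
  have "poch q p N = (1 - q * p ^ r) * (\<Prod>j\<in>{..<N} - {r}. 1 - q * p ^ j)"
    unfolding q_shifted_factorial_def by (rule prod.remove) (auto simp: N)
  moreover have "q * p ^ r = q ^ n"
    by (simp only: q_n)
  moreover have "locdvd Phi 1 (1 - q ^ n)"
    by (rule locdvd_one_minus_qvar[OF n_pos]) simp
  moreover have "locdvd Phi 0 (\<Prod>j\<in>{..<N} - {r}. 1 - q * p ^ j)"
    by (intro locdvd_prod locdvd_ring_intros locdvd_1 locdvd_q)
  ultimately show ?thesis
    by (simp add: locdvd_mult_right)
qed

definition main_factor :: ratfun where
  "main_factor = poch q p N ^ 2 / poch p p N ^ 2"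

lemma locdvd_main_factor: "locdvd Phi 2 main_factor"
  unfolding main_factor_def
  by (intro locdvd_divide_poch_power) (use locdvd_power[OF locdvd_poch_N, of 2] in simp_all)

lemma quad_family_poch:
  "quad_family Phi (poch (inverse q) p k) (poch (p ^ r) p k) (poch (q ^ (2 * n) / q) p k) (poch (1 / p ^ N) p k)"
proof -
  have t: "locdvd Phi 0 (q ^ n)" "locdvd Phi 1 (1 - q ^ n)" "locdvd Phi 0 (1 / (q ^ n)\<^sup>2)" "q ^ n \<noteq> 0"
    using locdvd_one_minus_qvar[OF n_pos dvd_refl] locdvd_divide_qvar_power[OF n_pos locdvd_1, of "n * 2"]
    by (simp_all flip: power_mult)
  have c: "locdvd Phi 0 (inverse q)"
    using locdvd_divide_qvar_power[OF n_pos locdvd_1, of 1] by (simp add: inverse_eq_divide)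
  have "(q ^ n)\<^sup>2 = q ^ (2 * n)"
    by (simp add: mult.commute flip: power_mult)
  then have "inverse q * q ^ n = p ^ r" "inverse q * (q ^ n)\<^sup>2 = q ^ (2 * n) / q" "inverse q / (q ^ n)\<^sup>2 = 1 / p ^ N"
    by (simp_all only: p_N) (simp_all add: q_n inverse_eq_divide)
  then show ?thesis
    using quad_family_qsf[OF c locdvd_qvar_power t, of 3 k] by simp
qed

lemma sum_integral_parameter_eq_0:
  "(\<Sum>k\<le>N. poch (1 / p ^ N) p k * poch (p ^ r) p k * poch (p ^ r) p k / poch p p k ^ 3 * p ^ (3 * k)) = 0"
proof -
  obtain s where s: "r = Suc s" using r by (cases r) auto
  \<comment> \<open>The bound is met with nothing to spare:
    \<open>2 * s + 2 = 2 * r = N - 1\<close>.\<close>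
  have "2 * s + 2 < N" using N s by simp
  then show ?thesis
    unfolding s by (intro sum_z3_integral_parameter_eq_0 p_powers)
qed

section \<open>The sum G(-2, 0, 2)\<close>

definition twisted_sum :: ratfun where
  "twisted_sum = (\<Sum>k\<le>N. poch (1 / p ^ N) p k * poch (1 / q) p k * poch (q ^ (2 * n) / q) p k /
     poch p p k ^ 3 * p ^ (3 * k))"

lemma twisted_sum_eq:
  "twisted_sum = main_factor * q ^ (2 * N) * (3 * (1 + q) + (q ^ (2 * n) - 1) * residual q (q ^ (2 * n)) /
     ((q - q ^ (2 * n))\<^sup>2 * (q ^ (2 * n) - q ^ 3) * (q ^ 3 * q ^ (2 * n) - 1) * q ^ (2 * n) * (1 - q)\<^sup>2))"
proof -
  let ?Q = "q ^ (2 * n)"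
  let ?b = "1 / q" and ?c = "?Q / q"
  have ne: "?Q \<noteq> 0" "q \<noteq> 1" "?Q \<noteq> 1" "q \<noteq> ?Q" "?Q \<noteq> q ^ 3" "q ^ 3 * ?Q \<noteq> 1"
    using qvar_power_eq_iff[of 1 0] qvar_power_eq_iff[of 1 "2 * n"] n_gt by (simp_all flip: power_add)
  have T: "(\<Sum>k\<le>N. saalschuetz_term p \<beta> N k) = \<beta> ^ N * (poch (p / \<beta>) p N / poch p p N)\<^sup>2"
    if "\<beta> \<noteq> 0" "\<And>j. \<beta> \<noteq> p ^ j" for \<beta>
    by (rule saalschuetz_special[OF p_powers that])
  \<comment> \<open>The three balanced sums have parameters q^2, q^5 and 1/q, whose exponents are 2
    modulo 3, so none is a power of \<open>p\<close>. The resulting products start at q, q^(-2) and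
    q^4; \<open>qsf_shift\<close> reduces the last two to the first.\<close>
  have bp: "?b * p = q ^ 2" "?b * p * p = q ^ 5"
    by (simp_all add: field_simps power_numeral_reduce)
  have T1: "(\<Sum>k\<le>N. saalschuetz_term p (?b * p) N k) = q ^ (2 * N) * main_factor"
  proof -
    have "q ^ 2 \<noteq> p ^ j" for j
      unfolding power_mult[symmetric] qvar_power_eq_iff by presburger
    moreover have "p / q ^ 2 = q" by (simp add: power2_eq_square power3_eq_cube)
    ultimately show ?thesis
      using T[of "q ^ 2"] unfolding bp(1) main_factor_def by (simp add: power_divide flip: power_mult)
  qed
  have T2: "(\<Sum>k\<le>N. saalschuetz_term p (?b * p * p) N k) =
      q ^ (2 * N) * main_factor * (q * ?Q * ((1 - 1 / q\<^sup>2) / (1 - ?Q / q))\<^sup>2)"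
  proof -
    have "q ^ 5 \<noteq> p ^ j" for j
      unfolding power_mult[symmetric] qvar_power_eq_iff by presburger
    then have "(\<Sum>k\<le>N. saalschuetz_term p (?b * p * p) N k) =
        (q ^ 5) ^ N * (poch (p / q ^ 5) p N / poch p p N)\<^sup>2"
      unfolding bp(2) by (intro T) auto
    also have "(q ^ 5) ^ N = q ^ (2 * N) * (q * ?Q)"
      unfolding p_N[symmetric] by (simp flip: power_mult power_add)
    also have "poch (p / q ^ 5) p N = poch q p N * ((1 - 1 / q\<^sup>2) / (1 - ?Q / q))"
    proof -
      have e: "1 / q\<^sup>2 * p = q" "1 / q\<^sup>2 * p ^ N = ?Q / q"
        unfolding p_N by (simp_all add: power2_eq_square power3_eq_cube)
      have e5: "p / q ^ 5 = 1 / q\<^sup>2"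
        by (simp add: power_numeral_reduce)
      have "poch (1 / q\<^sup>2) p N * (1 - ?Q / q) = poch q p N * (1 - 1 / q\<^sup>2)"
        using qsf_shift[of "1 / q\<^sup>2" p N] unfolding e by simp
      moreover have "1 - ?Q / q \<noteq> 0" using ne by simp
      ultimately show ?thesis
        unfolding e5 times_divide_eq_right by (intro eq_divide_imp)
    qed
    finally show ?thesis
      by (simp add: main_factor_def power_divide power_mult_distrib mult_ac)
  qed
  have T3: "(\<Sum>k\<le>N. saalschuetz_term p ?b N k) =
      q ^ (2 * N) * main_factor * (1 / (q * ?Q) * ((1 - ?Q * q\<^sup>2) / (1 - q))\<^sup>2)"
  proof -
    have "1 / q \<noteq> p ^ j" for j
    proof -
      have "p ^ j * q = q ^ Suc (3 * j)" by (simp add: power_mult)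
      then have "p ^ j * q \<noteq> 1" by (simp del: power_Suc)
      then show ?thesis by (auto simp: divide_eq_eq)
    qed
    then have "(\<Sum>k\<le>N. saalschuetz_term p ?b N k) = (1 / q) ^ N * (poch (p / (1 / q)) p N / poch p p N)\<^sup>2"
      by (intro T) auto
    also have "(1 / q) ^ N = q ^ (2 * N) * (1 / (q * ?Q))"
      unfolding p_N[symmetric] by (simp add: divide_simps flip: power_mult power_add)
    also have "poch (p / (1 / q)) p N = poch q p N * ((1 - ?Q * q\<^sup>2) / (1 - q))"
    proof -
      have "p / (1 / q) = q * p" "q * p ^ N = ?Q * q\<^sup>2"
        by (simp_all add: p_N power2_eq_square)
      then show ?thesis
        using qsf_shift[of q p N] ne by (simp add: eq_divide_eq mult.commute)
    qed
    finally show ?thesis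
      by (simp add: main_factor_def power_divide power_mult_distrib mult_ac)
  qed
  have "twisted_sum =
     - (1 + p) / ((p * ?c - ?b) * (?c - p * ?b)) * ((1 - ?b) * (1 - ?c)) * (\<Sum>k\<le>N. saalschuetz_term p (?b * p) N k) +
     (1 - ?b) * (1 - ?b * p) / ((?c - ?b) * (?c - p * ?b)) * (\<Sum>k\<le>N. saalschuetz_term p (?b * p * p) N k) +
     (1 - ?c) * (1 - ?c * p) / ((?c - ?b) * (p * ?c - ?b)) * (\<Sum>k\<le>N. saalschuetz_term p ?b N k)"
    unfolding twisted_sum_def
  proof (rule sum_z3_eq_saalschuetz)
    show "?b * ?c * p = p ^ N"
      unfolding p_N by (simp add: power3_eq_cube)
  qed (use ne in \<open>auto simp: divide_simps\<close>)
  also have "\<dots> = main_factor * q ^ (2 * N) *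
     (- (1 + p) / ((p * ?c - ?b) * (?c - p * ?b)) * ((1 - ?b) * (1 - ?c)) +
      (1 - ?b) * (1 - ?b * p) / ((?c - ?b) * (?c - p * ?b)) * (q * ?Q * ((1 - 1 / q\<^sup>2) / (1 - ?Q / q))\<^sup>2) +
      (1 - ?c) * (1 - ?c * p) / ((?c - ?b) * (p * ?c - ?b)) * (1 / (q * ?Q) * ((1 - ?Q * q\<^sup>2) / (1 - q))\<^sup>2))"
    unfolding T1 T2 T3 distrib_left by (simp only: mult_ac)
  also note residual_identity[OF qvar_nonzero ne]
  finally show ?thesis .
qed

lemma residual_locdvd: "locdvd Phi 0 (residual q (q ^ (2 * n)))"
  unfolding residual_def
  by (intro locdvd_add locdvd_diff locdvd_mult_left locdvd_minus locdvd_numeral locdvd_power_0 locdvd_q locdvd_1)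

lemma q_2N: "q ^ (2 * N) = q ^ (2 * n) / q ^ (2 * r)"
proof -
  have "2 * n = 2 * N + 2 * r" by (simp add: n N)
  then show ?thesis by (simp add: power_add)
qed

lemma twisted_sum_cong:
  "locdvd Phi 3 (twisted_sum - 3 * (1 + q) / q ^ (2 * r) * main_factor)"
proof -
  let ?Q = "q ^ (2 * n)"
  let ?W = "residual q ?Q"
  let ?x = "(?Q - 1) * ?W"
  let ?D = "(q - ?Q)\<^sup>2 * (?Q - q ^ 3) * (q ^ 3 * ?Q - 1) * ?Q * (1 - q)\<^sup>2"
  have Q1: "locdvd Phi 1 (?Q - 1)"
    using locdvd_minus[OF locdvd_one_minus_qvar[OF n_pos, of "2 * n"]] by simp
  have x: "locdvd Phi 1 ?x"
    by (rule locdvd_mult_right[OF Q1 residual_locdvd])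
  \<comment> \<open>Powers of q are pulled out until only factors \<open>1 - q ^ m\<close> remain,
    with \<open>m\<close> among 1, 2n - 1, 2n - 3, 2n + 3, none divisible by
    \<open>n\<close>.\<close>
  have D: "?D = q ^ (2 * n + 5) * (1 - q ^ (2 * n - 1)) * (1 - q ^ (2 * n - 1)) * (1 - q ^ (2 * n - 3)) *
      (1 - q ^ (2 * n + 3)) * (1 - q ^ 1) * (1 - q ^ 1)"
  proof -
    have "?Q = q * q ^ (2 * n - 1)" "?Q = q ^ 3 * q ^ (2 * n - 3)"
      using n_gt by (simp_all flip: power_Suc power_add)
    then have "q - ?Q = q * (1 - q ^ (2 * n - 1))" "?Q - q ^ 3 = - (q ^ 3 * (1 - q ^ (2 * n - 3)))"
      by (simp_all add: right_diff_distrib)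
    moreover have "q ^ 3 * ?Q - 1 = - (1 - q ^ (2 * n + 3))"
      by (simp add: power_add)
    ultimately have "?D = (q * (1 - q ^ (2 * n - 1)))\<^sup>2 * - (q ^ 3 * (1 - q ^ (2 * n - 3))) *
        - (1 - q ^ (2 * n + 3)) * ?Q * (1 - q)\<^sup>2"
      by (simp only:)
    also have "\<dots> = q ^ (2 * n + 5) * (1 - q ^ (2 * n - 1)) * (1 - q ^ (2 * n - 1)) * (1 - q ^ (2 * n - 3)) *
      (1 - q ^ (2 * n + 3)) * (1 - q ^ 1) * (1 - q ^ 1)"
    proof -
      have "q ^ (2 * n + 5) = ?Q * (q * q * q ^ 3)"
        by (simp add: power_add power_numeral_reduce)
      then show ?thesis
        by (simp only: power2_eq_square power_one_right mult_minus_left mult_minus_right minus_minus mult_ac)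
    qed
    finally show ?thesis .
  qed
  have "locdvd Phi 1 (?x / q ^ (2 * n + 5) / (1 - q ^ (2 * n - 1)) / (1 - q ^ (2 * n - 1)) / (1 - q ^ (2 * n - 3)) /
      (1 - q ^ (2 * n + 3)) / (1 - q ^ 1) / (1 - q ^ 1))"
    by (intro locdvd_divide_one_minus_qvar locdvd_divide_qvar_power n_pos x
        not_dvd_between not_dvd_2n_plus_3 not_dvd_small) (use n_gt in auto)
  then have xD: "locdvd Phi 1 (?x / ?D)"
    unfolding D by (simp only: divide_divide_eq_left)
  have Q: "locdvd Phi 0 (1 / q ^ (2 * r))"
    by (rule locdvd_divide_qvar_power[OF n_pos locdvd_1])
  \<comment> \<open>The cofactor of \<open>main_factor\<close> collects two errors of order one:
    replacing \<open>q ^ (2 * N)\<close> by q^(-2r), and dropping the residual term.\<close>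
  have "twisted_sum - 3 * (1 + q) / q ^ (2 * r) * main_factor =
      main_factor * (1 / q ^ (2 * r) * ((3 * (1 + q)) * (?Q - 1) + ?Q * (?x / ?D)))"
  proof -
    have "m * (Q / R) * (a + y) - a / R * m = m * (1 / R * (a * (Q - 1) + Q * y))" for m Q R a y :: ratfun
      by (simp add: algebra_simps diff_divide_distrib add_divide_distrib)
    then show ?thesis
      unfolding twisted_sum_eq q_2N .
  qed
  moreover have "locdvd Phi (2 + 1) (main_factor * (1 / q ^ (2 * r) * ((3 * (1 + q)) * (?Q - 1) + ?Q * (?x / ?D))))"
    by (intro locdvd_mult[OF locdvd_main_factor] locdvd_mult_left[OF Q] locdvd_add
        locdvd_mult_left[OF _ Q1] locdvd_mult_left[OF _ xD] locdvd_qvar_power)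
      (intro locdvd_mult_left locdvd_add locdvd_numeral locdvd_1 locdvd_q)
  ultimately show ?thesis by simp
qed

section \<open>Reduction of the sum of cubes\<close>

definition cube_sum :: ratfun where
  "cube_sum = (\<Sum>k\<le>N. poch (inverse q) p k ^ 3 / poch p p k ^ 3 * q ^ (9 * k))"

lemma locdvd_cube_sum: "locdvd Phi 0 cube_sum"
  unfolding cube_sum_def
proof (intro locdvd_sum locdvd_mult_right locdvd_qvar_power locdvd_divide_poch_power locdvd_power_0)
  fix k
  show "locdvd Phi 0 (poch (inverse q) p k)"
    using quad_family_poch[of k] by (simp add: quad_family_def)
qed auto

lemma cube_sum_cong_twisted: "locdvd Phi 3 (cube_sum + 3 * twisted_sum)"
proof -
  let ?f0 = "poch (inverse q) p" and ?f1 = "poch (p ^ r) p" and ?f2 = "poch (q ^ (2 * n) / q) p"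
    and ?g = "poch (1 / p ^ N) p"
  \<comment> \<open>The 0 stands for the vanishing G(-2, 1, 1); once it is expanded, the three sums
    combine termwise and \<open>quad_family_cube\<close> applies.\<close>
  have "cube_sum + 3 * twisted_sum = cube_sum - (4 * 0 - 3 * twisted_sum)"
    by simp
  also have "\<dots> = (\<Sum>k\<le>N. (?f0 k ^ 3 - (4 * (?g k * ?f1 k * ?f1 k) - 3 * (?g k * ?f0 k * ?f2 k))) /
      poch p p k ^ 3 * p ^ (3 * k))"
    unfolding cube_sum_def twisted_sum_def sum_integral_parameter_eq_0[symmetric] sum_distrib_left
      sum_subtractf[symmetric]
    by (intro sum.cong refl)
      (simp add: inverse_eq_divide diff_divide_distrib left_diff_distrib flip: power_mult)
  also have "locdvd Phi 3 \<dots>"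
    by (intro locdvd_sum locdvd_mult_right locdvd_divide_poch_power quad_family_cube quad_family_poch)
      (auto simp flip: power_mult)
  finally show ?thesis .
qed

section \<open>The right-hand side of the congruence\<close>

lemma locdvd_divide_q_integer:
  assumes "\<not> n dvd m" "locdvd Phi k x"
  shows "locdvd Phi k (x / q_integer m ^ 2)"
proof -
  have "locdvd Phi k ((1 - q) ^ 2 * x / (1 - q ^ m) / (1 - q ^ m))"
    by (intro locdvd_divide_one_minus_qvar n_pos assms locdvd_mult_left locdvd_power_0 locdvd_diff locdvd_1 locdvd_q)
  then show ?thesis
    by (simp add: q_integer_def power_divide power2_eq_square mult_ac)
qed

definition closed_form :: ratfun where
  "closed_form = q powi (- 2 * int r) * (1 + q) * (poch q p N ^ 2 / poch p p N ^ 2) *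
     (3 - q_integer (2 * n) ^ 2 *
       ((\<Sum>i = 1..N. 3 * q ^ (3 * i - 2) / q_integer (3 * i - 2) ^ 2) - (1 + 5 * q + 3 * q ^ 2) / (1 + q)))"

lemma closed_form_cong: "locdvd Phi 3 (closed_form + 9 * ((1 + q) / q ^ (2 * r) * main_factor))"
proof -
  let ?C = "(1 + q) / q ^ (2 * r) * main_factor"
  let ?h = "\<lambda>i. 3 * q ^ (3 * i - 2) / q_integer (3 * i - 2) ^ 2"
  let ?R = "\<Sum>i\<in>{1..N} - {r + 1}. ?h i"
  let ?E = "(1 + 5 * q + 3 * q ^ 2) / (1 + q)"
  have ne: "1 - q \<noteq> 0" "1 - q ^ n \<noteq> 0" "1 - q ^ (2 * n) \<noteq> 0" "1 + q \<noteq> 0"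
  proof -
    show "1 - q \<noteq> 0" using qvar_power_eq_iff[of 1 0] by simp
    show "1 - q ^ n \<noteq> 0" "1 - q ^ (2 * n) \<noteq> 0" using n_pos by simp_all
    have "(1 + q) * (1 - q) = 1 - q ^ 2" by (simp add: algebra_simps power2_eq_square)
    moreover have "1 - q ^ 2 \<noteq> 0" by simp
    ultimately show "1 + q \<noteq> 0" by fastforce
  qed
  \<comment> \<open>All exponents \<open>3 * i - 2\<close> lie below \<open>2 * n\<close>, so only
    \<open>i = r + 1\<close>, with exponent \<open>n\<close>, has a denominator not coprime to
    \<open>Phi\<close>.\<close>
  have sum: "(\<Sum>i = 1..N. ?h i) = 3 * q ^ n / q_integer n ^ 2 + ?R"
  proof -
    have "3 * (r + 1) - 2 = n" by (simp add: n)
    moreover have "(\<Sum>i = 1..N. ?h i) = ?h (r + 1) + ?R"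
      by (rule sum.remove) (auto simp: N)
    ultimately show ?thesis by simp
  qed
  have R: "locdvd Phi 0 ?R"
  proof (intro locdvd_sum locdvd_divide_q_integer locdvd_mult_left locdvd_numeral locdvd_qvar_power)
    fix i assume i: "i \<in> {1..N} - {r + 1}"
    show "\<not> n dvd 3 * i - 2"
    proof
      assume "n dvd 3 * i - 2"
      moreover have "0 < 3 * i - 2" "3 * i - 2 < 2 * n" using i n N by auto
      moreover have "3 * i - 2 \<noteq> n" using i n by auto
      ultimately show False
        using not_dvd_between[of "3 * i - 2"] not_dvd_small[of "3 * i - 2"] by (meson linorder_neqE_nat)
    qed
  qed
  \<comment> \<open>Expanding by \<open>1 - q\<close> turns the denominator into
    \<open>1 - q ^ 2\<close>, and \<open>n\<close> does not divide 2.\<close>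
  have E: "locdvd Phi 0 ?E"
  proof -
    have "\<not> n dvd 2" using n_gt by (intro not_dvd_small) auto
    moreover have "locdvd Phi 0 ((1 - q) * (1 + 5 * q + 3 * q ^ 2))"
      by (intro locdvd_mult_left locdvd_add locdvd_diff locdvd_numeral locdvd_1 locdvd_q locdvd_qvar_power)
    ultimately have "locdvd Phi 0 ((1 - q) * (1 + 5 * q + 3 * q ^ 2) / (1 - q ^ 2))"
      by (rule locdvd_divide_one_minus_qvar[OF n_pos])
    moreover have "1 - q ^ 2 = (1 - q) * (1 + q)" by (simp add: algebra_simps power2_eq_square)
    ultimately show ?thesis using ne by simp
  qed
  have q2n: "locdvd Phi 1 (q_integer (2 * n) ^ 2)"
  proof -
    have "\<not> n dvd 1" using n_gt by (intro not_dvd_small) auto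
    then have "locdvd Phi 1 ((1 - q ^ (2 * n)) / (1 - q ^ 1))"
      by (intro locdvd_divide_one_minus_qvar n_pos locdvd_one_minus_qvar) auto
    then have "locdvd Phi (1 * 2) (q_integer (2 * n) ^ 2)"
      unfolding q_integer_def by (intro locdvd_power) simp
    then show ?thesis by (rule locdvd_mono) simp
  qed
  \<comment> \<open>The relation [2n] = [n] (1 + q^n) cancels the double pole.\<close>
  have lead: "q_integer (2 * n) ^ 2 * (3 * q ^ n / q_integer n ^ 2) = 3 * q ^ n * (1 + q ^ n)\<^sup>2"
  proof -
    have "q ^ (2 * n) = q ^ n * q ^ n" by (simp add: mult_2 power_add)
    then have "1 - q ^ (2 * n) = (1 - q ^ n) * (1 + q ^ n)"
      by (simp only:) (simp add: algebra_simps)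
    then have "q_integer (2 * n) = q_integer n * (1 + q ^ n)"
      by (simp add: q_integer_def)
    moreover have "q_integer n \<noteq> 0" using ne by (simp add: q_integer_def)
    ultimately show ?thesis by (simp add: power_mult_distrib)
  qed
  have "closed_form + 9 * ?C = ?C * (3 * (4 + 3 * q ^ n + (q ^ n)\<^sup>2) * (1 - q ^ n) + (?E - ?R) * q_integer (2 * n) ^ 2)"
  proof -
    have "q powi (- 2 * int r) = 1 / q ^ (2 * r)"
      using power_int_minus[of q "int (2 * r)"]
      unfolding power_int_of_nat by (simp add: inverse_eq_divide)
    then have closed: "closed_form = ?C * (3 - q_integer (2 * n) ^ 2 * (3 * q ^ n / q_integer n ^ 2 + ?R - ?E))"
      unfolding closed_form_def main_factor_def sum by simp
    have "3 - q_integer (2 * n) ^ 2 * (3 * q ^ n / q_integer n ^ 2 + ?R - ?E) =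
        3 - q_integer (2 * n) ^ 2 * (3 * q ^ n / q_integer n ^ 2) + (?E - ?R) * q_integer (2 * n) ^ 2"
      by (simp only: algebra_simps)
    also have "\<dots> = 3 - 3 * q ^ n * (1 + q ^ n)\<^sup>2 + (?E - ?R) * q_integer (2 * n) ^ 2"
      by (simp only: lead)
    finally have *: "closed_form = ?C * (3 - 3 * q ^ n * (1 + q ^ n)\<^sup>2 + (?E - ?R) * q_integer (2 * n) ^ 2)"
      unfolding closed by (simp only:)
    \<comment> \<open>The polynomial 3 - 3t(1 + t)^2 + 9 vanishes at t = 1, which yields the factor
      \<open>1 - t\<close>.\<close>
    have "C * (3 - 3 * t * (1 + t)\<^sup>2 + z) + 9 * C = C * (3 * (4 + 3 * t + t\<^sup>2) * (1 - t) + z)" for C t z :: ratfun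
      by (simp add: algebra_simps power2_eq_square)
    then show ?thesis unfolding * .
  qed
  moreover have "locdvd Phi (2 + 1) (?C * (3 * (4 + 3 * q ^ n + (q ^ n)\<^sup>2) * (1 - q ^ n) + (?E - ?R) * q_integer (2 * n) ^ 2))"
  proof (rule locdvd_mult)
    show "locdvd Phi 2 ?C"
      by (intro locdvd_mult_left locdvd_main_factor locdvd_divide_qvar_power n_pos locdvd_add locdvd_1 locdvd_q)
    have "locdvd Phi 1 (1 - q ^ n)" by (rule locdvd_one_minus_qvar[OF n_pos]) simp
    moreover have "locdvd Phi 0 (3 * (4 + 3 * q ^ n + (q ^ n)\<^sup>2))"
      by (intro locdvd_mult_left locdvd_add locdvd_numeral locdvd_power_0 locdvd_q)
    moreover have "locdvd Phi 0 (?E - ?R)" by (rule locdvd_diff[OF E R])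
    ultimately show "locdvd Phi 1 (3 * (4 + 3 * q ^ n + (q ^ n)\<^sup>2) * (1 - q ^ n) + (?E - ?R) * q_integer (2 * n) ^ 2)"
      using q2n by (intro locdvd_add locdvd_mult_left[of Phi "3 * (4 + 3 * q ^ n + (q ^ n)\<^sup>2)"]
          locdvd_mult_left[of Phi "?E - ?R"])
  qed
  ultimately show ?thesis by simp
qed

lemma cube_sum_cong: "ratfun_cong cube_sum closed_form (Phi ^ 3)"
proof (rule ratfun_congI)
  let ?C = "(1 + q) / q ^ (2 * r) * main_factor"
  show "locdvd Phi 0 cube_sum" by (rule locdvd_cube_sum)
  \<comment> \<open>Integrality of \<open>closed_form\<close> is drawn from its congruence, since
    its summand with denominator [n]^2 is not integral by itself.\<close>
  have "locdvd Phi 0 (1 + q)" "locdvd Phi 0 main_factor"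
    using locdvd_mono[OF locdvd_main_factor] by (auto intro: locdvd_add)
  then have "locdvd Phi 0 (9 * ?C)"
    by (intro locdvd_mult_left locdvd_numeral locdvd_divide_qvar_power n_pos)
  then show "locdvd Phi 0 closed_form"
    using locdvd_diff[OF locdvd_mono[OF closed_form_cong, of 0]] by fastforce
  \<comment> \<open>The chain is \<open>cube_sum\<close> \<equiv> -3 \<open>twisted_sum\<close>
    \<equiv> -9 \<open>?C\<close> \<equiv> \<open>closed_form\<close>.\<close>
  have "cube_sum - closed_form = (cube_sum + 3 * twisted_sum) - 3 * (twisted_sum - 3 * (1 + q) / q ^ (2 * r) * main_factor)
      - (closed_form + 9 * ?C)"
    by (simp add: algebra_simps)
  then show "locdvd Phi 3 (cube_sum - closed_form)"
    using locdvd_diff[OF locdvd_diff[OF cube_sum_cong_twisted locdvd_mult_left[OF locdvd_numeral twisted_sum_cong]] closed_form_cong]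
    by metis
qed

end

theorem theorem1p1:
  fixes n :: nat
  assumes "n > 1" and "[n = 1] (mod 6)"
  shows "ratfun_cong
    (\<Sum>k = 0..(2 * n + 1) div 3.
       q_shifted_factorial (inverse qvar) (qvar ^ 3) k ^ 3 /
       q_shifted_factorial (qvar ^ 3) (qvar ^ 3) k ^ 3 * qvar ^ (9 * k))
    (qvar powi ((2 - 2 * int n) div 3) * (1 + qvar) *
       (q_shifted_factorial qvar (qvar ^ 3) ((2 * n + 1) div 3) ^ 2 /
        q_shifted_factorial (qvar ^ 3) (qvar ^ 3) ((2 * n + 1) div 3) ^ 2) *
       (3 - q_integer (2 * n) ^ 2 *
         ((\<Sum>i = 1..(2 * n + 1) div 3. 3 * qvar ^ (3 * i - 2) / q_integer (3 * i - 2) ^ 2) -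
          (1 + 5 * qvar + 3 * qvar ^ 2) / (1 + qvar))))
    (cyclotomic n ^ 3)"
proof -
  define r where "r = n div 3"
  have "n mod 6 = 1" using assms by (simp add: cong_def)
  then have n: "n = 3 * r + 1" unfolding r_def by presburger
  interpret cyclotomic_setup n r "2 * r + 1"
    using n assms(1) by unfold_locales auto
  \<comment> \<open>Both divisions are exact: 2n + 1 = 3(2r + 1) and 2 - 2n = -6r.\<close>
  have N: "(2 * n + 1) div 3 = 2 * r + 1" and e: "(2 - 2 * int n) div 3 = - 2 * int r"
    using n by simp_all
  show ?thesis
    using cube_sum_cong unfolding cube_sum_def closed_form_def N e atMost_atLeast0 .
qed

end
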